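(* Let $\mathcal{H}$ be a complex, infinite-dimensional, separable Hilbert space and let $\mathcal{S} \subseteq \mathcal{B}(\mathcal{H})$ be a unital semigroup of partial isometries such that $\mathcal{Q}(\mathcal{S})$ is commutative and the von Neumann algebra $W^*(\mathcal{Q}(\mathcal{S}))$ has uniform finite multiplicity. Then the semigroup $\mathcal{T} = \langle \mathcal{S} \cup \mathcal{S}^* \rangle$ consists of partial isometries.
   Context: $\mathcal{B}(\mathcal{H})$ is the algebra of bounded linear operators on $\mathcal{H}$. A semigroup in $\mathcal{B}(\mathcal{H})$ is a non-empty subset closed under operator multiplication; it is unital if it contains the identity operator $I$. A partial isometry is an operator $V$ such that $VV^*$ (equivalently $V^*V$) is an orthogonal projection; $Q_V := VV^*$ is its range (final) projection. $\mathcal{Q}(\mathcal{S}) = \{Q_S : S \in \mathcal{S}\}$, $\mathcal{S}^* = \{S^* : S\in\mathcal{S}\}$, $\langle \mathcal{A} \rangle$ is the semigroup generated by a set $\mathcal{A}$ of operators (all finite products of elements of $\mathcal{A}$), and $W^*(\mathcal{A})$ is the von Neumann algebra generated by $\mathcal{A}$. Multiplicity: an abelian von Neumann algebra $\mathfrak{N}$ on a separable Hilbert space $\mathcal{H}$ is unitarily equivalent to the algebra of diagonalizable operators on a direct integral $\int_\Omega^\oplus \mathcal{H}_p\, d\mu(p)$ of nonzero separable Hilbert spaces, where $\Omega\subseteq\mathbb{R}$ is compact and $\mu$ is a positive regular Borel measure on $\Omega$. $\mathfrak{N}$ has uniform multiplicity $n$ ($1\le n\le\infty$) if $\dim\mathcal{H}_p=n$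 for almost every $p$; it has uniform finite multiplicity if this holds for some $n<\infty$. *)

theory Defs
  imports "HOL-Analysis.Analysis" "HOL-Library.Extended_Nat"
begin

section \<open>Complex Hilbert spaces\<close>

text \<open>The inner product is linear in its first argument.  Neither separability
  nor infinite dimension is part of the class; the real structure inherited from \<^class>\<open>banach\<close> is the restriction
  of the complex one.\<close>

class complex_hilbert = banach +
  fixes scaleC :: "complex \<Rightarrow> 'a \<Rightarrow> 'a" (infixr "*\<^sub>C" 75)
    and cinner :: "'a \<Rightarrow> 'a \<Rightarrow> complex"
  assumes scaleR_eq_scaleC: "scaleR r x = complex_of_real r *\<^sub>C x"
    and scaleC_add_right: "a *\<^sub>C (x + y) = a *\<^sub>C x + a *\<^sub>C y"
    and scaleC_add_left: "(a + b) *\<^sub>C x = a *\<^sub>C x + b *\<^sub>C x"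
    and scaleC_scaleC: "a *\<^sub>C b *\<^sub>C x = (a * b) *\<^sub>C x"
    and scaleC_one: "1 *\<^sub>C x = x"
    and cinner_add_left: "cinner (x + y) z = cinner x z + cinner y z"
    and cinner_scaleC_left: "cinner (a *\<^sub>C x) y = a * cinner x y"
    and cinner_commute: "cinner y x = cnj (cinner x y)"
    and cinner_self: "cinner x x = complex_of_real ((norm x)\<^sup>2)"

global_interpretation complex_vector:
  vector_space "scaleC :: complex \<Rightarrow> 'a \<Rightarrow> 'a::complex_hilbert"
  defines cspan = complex_vector.span
    and csubspace = complex_vector.subspace
  by standard (simp_all add: scaleC_add_right scaleC_add_left scaleC_scaleC scaleC_one)

definition orthonormal :: "'a::complex_hilbert set \<Rightarrow> bool" where
  "orthonormal B \<longleftrightarrow> (\<forall>x\<in>B. \<forall>y\<in>B. cinner x y = (if x = y then 1 else 0))"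

text \<open>Hilbert space dimension of a closed subspace, via an orthonormal basis. The value
  \<^term>\<open>\<infinity>\<close> does not distinguish infinite cardinals.\<close>

definition has_hilbert_dim :: "'a::complex_hilbert set \<Rightarrow> enat \<Rightarrow> bool" where
  "has_hilbert_dim V n \<longleftrightarrow>
     (\<exists>B. orthonormal B \<and> closure (cspan B) = V \<and>
          n = (if finite B then enat (card B) else \<infinity>))"


section \<open>Bounded operators and partial isometries\<close>

definition bounded_ops :: "('a::complex_hilbert \<Rightarrow> 'a) set" where
  "bounded_ops = {T. bounded_linear T \<and> (\<forall>c x. T (c *\<^sub>C x) = c *\<^sub>C T x)}"

text \<open>For bounded operators the adjoint exists and is unique by the Riesz representation
  theorem; nothing is claimed about other arguments.\<close>

definition adj :: "('a::complex_hilbert \<Rightarrow> 'a) \<Rightarrow> ('a \<Rightarrow> 'a)" where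
  "adj T = (THE R. R \<in> bounded_ops \<and> (\<forall>x y. cinner (T x) y = cinner x (R y)))"

definition orthogonal_projection :: "('a::complex_hilbert \<Rightarrow> 'a) \<Rightarrow> bool" where
  "orthogonal_projection P \<longleftrightarrow> P \<in> bounded_ops \<and> P \<circ> P = P \<and> adj P = P"

definition range_projection :: "('a::complex_hilbert \<Rightarrow> 'a) \<Rightarrow> ('a \<Rightarrow> 'a)" where
  "range_projection V = V \<circ> adj V"

definition partial_isometry :: "('a::complex_hilbert \<Rightarrow> 'a) \<Rightarrow> bool" where
  "partial_isometry V \<longleftrightarrow> V \<in> bounded_ops \<and> orthogonal_projection (range_projection V)"

definition operator_semigroup :: "('a::complex_hilbert \<Rightarrow> 'a) set \<Rightarrow> bool" where
  "operator_semigroup S \<longleftrightarrow>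
     S \<noteq> {} \<and> S \<subseteq> bounded_ops \<and> (\<forall>A\<in>S. \<forall>B\<in>S. A \<circ> B \<in> S)"

inductive_set generated_semigroup :: "('a \<Rightarrow> 'a) set \<Rightarrow> ('a \<Rightarrow> 'a) set"
  for A :: "('a \<Rightarrow> 'a) set" where
  base: "T \<in> A \<Longrightarrow> T \<in> generated_semigroup A"
| mult: "R \<in> generated_semigroup A \<Longrightarrow> T \<in> generated_semigroup A \<Longrightarrow>
         R \<circ> T \<in> generated_semigroup A"

definition commutative_set :: "('a \<Rightarrow> 'a) set \<Rightarrow> bool" where
  "commutative_set A \<longleftrightarrow> (\<forall>R\<in>A. \<forall>T\<in>A. R \<circ> T = T \<circ> R)"


section \<open>Von Neumann algebras\<close>

text \<open>The coarsest topology making every \<open>T \<mapsto> \<langle>T x, y\<rangle>\<close> continuous: the codomain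
  \<open>'a \<times> 'a \<Rightarrow> complex\<close> below carries the product topology.\<close>

definition weak_operator_topology :: "('a::complex_hilbert \<Rightarrow> 'a) topology" where
  "weak_operator_topology =
     pullback_topology bounded_ops (\<lambda>T. \<lambda>(x, y). cinner (T x) y) euclidean"

definition von_neumann_algebra :: "('a::complex_hilbert \<Rightarrow> 'a) set \<Rightarrow> bool" where
  "von_neumann_algebra M \<longleftrightarrow>
     M \<subseteq> bounded_ops \<and> id \<in> M \<and>
     (\<forall>R\<in>M. \<forall>T\<in>M. (\<lambda>x. R x + T x) \<in> M) \<and>
     (\<forall>c. \<forall>T\<in>M. (\<lambda>x. c *\<^sub>C T x) \<in> M) \<and>
     (\<forall>R\<in>M. \<forall>T\<in>M. R \<circ> T \<in> M) \<and>
     (\<forall>T\<in>M. adj T \<in> M) \<and>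
     closedin weak_operator_topology M"

definition generated_vN :: "('a::complex_hilbert \<Rightarrow> 'a) set \<Rightarrow> ('a \<Rightarrow> 'a) set" where
  "generated_vN A = \<Inter>{M. von_neumann_algebra M \<and> A \<subseteq> M}"


section \<open>Direct integrals and uniform multiplicity\<close>

definition regular_borel_measure :: "real set \<Rightarrow> real measure \<Rightarrow> bool" where
  "regular_borel_measure \<Omega> \<mu> \<longleftrightarrow>
     space \<mu> = \<Omega> \<and> sets \<mu> = sets (restrict_space borel \<Omega>) \<and> finite_measure \<mu> \<and>
     (\<forall>A\<in>sets \<mu>.
        emeasure \<mu> A = (INF W\<in>{W. openin (top_of_set \<Omega>) W \<and> A \<subseteq> W}. emeasure \<mu> W) \<and>
        emeasure \<mu> A = (SUP K\<in>{K. compact K \<and> K \<subseteq> A}. emeasure \<mu> K))"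

text \<open>A measurable field of nonzero separable Hilbert spaces \<open>p \<mapsto> H p\<close> over \<open>\<mu>\<close>, with
  fundamental sequence \<open>e\<close> of measurable vector fields.  The fibres are closed subspaces of
  the space \<open>'a\<close>; when \<open>'a\<close> is infinite-dimensional and separable this is no restriction,
  because every separable Hilbert space is then isometric to such a subspace.\<close>

definition measurable_field ::
  "real measure \<Rightarrow> (real \<Rightarrow> 'a::complex_hilbert set) \<Rightarrow> (nat \<Rightarrow> real \<Rightarrow> 'a) \<Rightarrow> bool" where
  "measurable_field \<mu> H e \<longleftrightarrow>
     (\<forall>p\<in>space \<mu>. closed (H p) \<and> csubspace (H p) \<and> H p \<noteq> {0}) \<and>
     (\<forall>p\<in>space \<mu>. closure (cspan (range (\<lambda>k. e k p))) = H p) \<and>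
     (\<forall>j k. (\<lambda>p. cinner (e j p) (e k p)) \<in> borel_measurable \<mu>)"

text \<open>Square-integrable measurable vector fields, before identifying fields that agree almost
  everywhere.\<close>

definition direct_integral ::
  "real measure \<Rightarrow> (real \<Rightarrow> 'a::complex_hilbert set) \<Rightarrow> (nat \<Rightarrow> real \<Rightarrow> 'a) \<Rightarrow> (real \<Rightarrow> 'a) set"
where
  "direct_integral \<mu> H e =
     {f. (\<forall>p\<in>space \<mu>. f p \<in> H p) \<and>
         (\<forall>k. (\<lambda>p. cinner (f p) (e k p)) \<in> borel_measurable \<mu>) \<and>
         integrable \<mu> (\<lambda>p. (norm (f p))\<^sup>2)}"

text \<open>\<open>U\<close> picks representatives of a unitary from \<open>'a\<close> onto the direct integral modulo
  almost everywhere equality.\<close>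

definition direct_integral_unitary ::
  "real measure \<Rightarrow> (real \<Rightarrow> 'a::complex_hilbert set) \<Rightarrow> (nat \<Rightarrow> real \<Rightarrow> 'a) \<Rightarrow>
   ('a \<Rightarrow> real \<Rightarrow> 'a) \<Rightarrow> bool" where
  "direct_integral_unitary \<mu> H e U \<longleftrightarrow>
     (\<forall>v. U v \<in> direct_integral \<mu> H e) \<and>
     (\<forall>v w. AE p in \<mu>. U (v + w) p = U v p + U w p) \<and>
     (\<forall>c v. AE p in \<mu>. U (c *\<^sub>C v) p = c *\<^sub>C U v p) \<and>
     (\<forall>v w. cinner v w = (LINT p|\<mu>. cinner (U v p) (U w p))) \<and>
     (\<forall>f\<in>direct_integral \<mu> H e. \<exists>v. AE p in \<mu>. U v p = f p)"

text \<open>The operators on \<open>'a\<close> that \<open>U\<close> carries to a diagonalizable operator, i.e. to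
  multiplication by an essentially bounded measurable scalar function.\<close>

definition diagonalizable_ops ::
  "real measure \<Rightarrow> ('a::complex_hilbert \<Rightarrow> real \<Rightarrow> 'a) \<Rightarrow> ('a \<Rightarrow> 'a) set" where
  "diagonalizable_ops \<mu> U =
     {T \<in> bounded_ops. \<exists>\<phi> :: real \<Rightarrow> complex.
        \<phi> \<in> borel_measurable \<mu> \<and> (\<exists>K. AE p in \<mu>. cmod (\<phi> p) \<le> K) \<and>
        (\<forall>v. AE p in \<mu>. U (T v) p = \<phi> p *\<^sub>C U v p)}"

definition uniform_multiplicity :: "('a::complex_hilbert \<Rightarrow> 'a) set \<Rightarrow> enat \<Rightarrow> bool" where
  "uniform_multiplicity N n \<longleftrightarrow> 1 \<le> n \<and>
     (\<exists>\<Omega> \<mu> H e U. compact \<Omega> \<and> regular_borel_measure \<Omega> \<mu> \<and> measurable_field \<mu> H e \<and>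
        direct_integral_unitary \<mu> H e U \<and> N = diagonalizable_ops \<mu> U \<and>
        (AE p in \<mu>. has_hilbert_dim (H p) n))"

definition uniform_finite_multiplicity :: "('a::complex_hilbert \<Rightarrow> 'a) set \<Rightarrow> bool" where
  "uniform_finite_multiplicity N \<longleftrightarrow> (\<exists>n. n < \<infinity> \<and> uniform_multiplicity N n)"

end

theory Submission
  imports Defs "Jordan_Normal_Form.Determinant"
begin

text \<open>Write \<open>N\<close> for the von Neumann algebra of the range projections. Products \<open>V \<circ> B\<close> of semigroup
  elements are partial isometries, so \<open>V\<^sup>*V\<close> commutes with every \<open>BB\<^sup>*\<close>, and since \<open>N\<close> is generated
  by such projections, \<open>V N V\<^sup>* \<subseteq> N\<close>. The point is that also \<open>V\<^sup>* N V \<subseteq> N\<close>. Uniform multiplicity \<open>n\<close>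
  provides \<open>n \<times> n\<close> matrix units \<open>E\<^sub>i\<^sub>j\<close> in the commutant of \<open>N\<close>, whose elements act fibrewise as
  \<open>n \<times> n\<close> matrices. The operators \<open>V\<^sup>*E\<^sub>i\<^sub>jV\<close> are again matrix units in this commutant, so in
  almost every fibre they vanish or span all matrices. For \<open>Y \<in> N\<close> the operator
  \<open>V\<^sup>*YV\<close> commutes with them and is absorbed by their diagonal sum \<open>V\<^sup>*V\<close>; hence it is scalar in
  almost every fibre, which means that it lies in \<open>N\<close>. The three properties of being a partial isometry,
  \<open>T N T\<^sup>* \<subseteq> N\<close> and \<open>T\<^sup>* N T \<subseteq> N\<close> are then preserved by adjoints and, as \<open>N\<close> is
  abelian, by products.\<close>

section \<open>Complex Hilbert spaces\<close>

lemma cinner_zero_left [simp]: "cinner 0 (y::'a::complex_hilbert) = 0"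
  using cinner_scaleC_left[of 0 "0::'a" y] by simp

lemma cinner_minus_left: "cinner (- x) (y::'a::complex_hilbert) = - cinner x y"
  using cinner_scaleC_left[of "- 1" x y] by (simp add: scaleC_one)

lemma cinner_diff_left: "cinner (x - z) (y::'a::complex_hilbert) = cinner x y - cinner z y"
  using cinner_add_left[of x "- z" y] by (simp add: cinner_minus_left)

lemma cinner_zero_right [simp]: "cinner (x::'a::complex_hilbert) 0 = 0"
  by (subst cinner_commute) simp

lemma cinner_add_right: "cinner (x::'a::complex_hilbert) (y + z) = cinner x y + cinner x z"
  using arg_cong[OF cinner_add_left[of y z x], of cnj] by (simp flip: cinner_commute)

lemma cinner_diff_right: "cinner (x::'a::complex_hilbert) (y - z) = cinner x y - cinner x z"
  using arg_cong[OF cinner_diff_left[of y z x], of cnj] by (simp flip: cinner_commute)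

lemma cinner_scaleC_right: "cinner (x::'a::complex_hilbert) (a *\<^sub>C y) = cnj a * cinner x y"
  using arg_cong[OF cinner_scaleC_left[of a y x], of cnj] by (simp flip: cinner_commute)

lemma cinner_sum_left: "cinner (\<Sum>i\<in>A. f i) (y::'a::complex_hilbert) = (\<Sum>i\<in>A. cinner (f i) y)"
  by (induction A rule: infinite_finite_induct) (auto simp: cinner_add_left)

lemma cinner_sum_right: "cinner (y::'a::complex_hilbert) (\<Sum>i\<in>A. f i) = (\<Sum>i\<in>A. cinner y (f i))"
  by (induction A rule: infinite_finite_induct) (auto simp: cinner_add_right)

lemma cinner_self_eq_0_iff [simp]: "cinner x x = 0 \<longleftrightarrow> (x::'a::complex_hilbert) = 0"
  by (simp add: cinner_self)

lemma norm_sq_eq: "(norm (x::'a::complex_hilbert))\<^sup>2 = Re (cinner x x)"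
  by (simp add: cinner_self)

lemma norm_scaleC: "norm (a *\<^sub>C (x::'a::complex_hilbert)) = cmod a * norm x"
proof -
  have "complex_of_real ((norm (a *\<^sub>C x))\<^sup>2) = a * cnj a * complex_of_real ((norm x)\<^sup>2)"
    by (simp add: cinner_self[symmetric] cinner_scaleC_left cinner_scaleC_right mult.assoc del: of_real_power)
  also have "\<dots> = complex_of_real ((cmod a * norm x)\<^sup>2)"
    by (simp add: complex_norm_square[symmetric] power_mult_distrib)
  finally have "(norm (a *\<^sub>C x))\<^sup>2 = (cmod a * norm x)\<^sup>2"
    using of_real_eq_iff by blast
  then show ?thesis by simp
qed

lemma norm_add_sq:
  "(norm (x + y))\<^sup>2 = (norm x)\<^sup>2 + 2 * Re (cinner x y) + (norm (y::'a::complex_hilbert))\<^sup>2"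
proof -
  have "Re (cinner y x) = Re (cinner x y)"
    by (subst cinner_commute) simp
  then show ?thesis
    by (simp add: norm_sq_eq cinner_add_left cinner_add_right)
qed

lemma norm_diff_sq:
  "(norm (x - y))\<^sup>2 = (norm x)\<^sup>2 - 2 * Re (cinner x y) + (norm (y::'a::complex_hilbert))\<^sup>2"
proof -
  have "Re (cinner y x) = Re (cinner x y)"
    by (subst cinner_commute) simp
  then show ?thesis
    by (simp add: norm_sq_eq cinner_diff_left cinner_diff_right)
qed

lemma cauchy_schwarz: "cmod (cinner x y) \<le> norm x * norm (y::'a::complex_hilbert)"
proof (cases "y = 0")
  case False
  \<comment> \<open>\<open>a *\<^sub>C y\<close> is the orthogonal projection of \<open>x\<close>
    onto the line of \<open>y\<close>. The inequality says that \<open>x - a *\<^sub>C y\<close> has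
    nonnegative squared norm.\<close>
  define a where "a = cinner x y / complex_of_real ((norm y)\<^sup>2)"
  have ny: "(norm y)\<^sup>2 > 0" using False by simp
  have 1: "cmod a * (norm y)\<^sup>2 = cmod (cinner x y)"
    using ny by (simp add: a_def norm_divide norm_power)
  have "cnj a * cinner x y = complex_of_real ((cmod a)\<^sup>2 * (norm y)\<^sup>2)"
    using ny by (simp add: a_def norm_divide norm_power complex_norm_square[symmetric] field_simps
        power2_eq_square complex_mult_cnj cmod_power2[symmetric] flip: of_real_mult)
  then have "Re (cinner x (a *\<^sub>C y)) = (cmod a)\<^sup>2 * (norm y)\<^sup>2"
    by (simp add: cinner_scaleC_right)
  moreover have "(norm (a *\<^sub>C y))\<^sup>2 = (cmod a)\<^sup>2 * (norm y)\<^sup>2"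
    by (simp add: norm_scaleC power_mult_distrib)
  ultimately have "0 \<le> (norm x)\<^sup>2 - (cmod a)\<^sup>2 * (norm y)\<^sup>2"
    using norm_diff_sq[of x "a *\<^sub>C y"] zero_le_power2[of "norm (x - a *\<^sub>C y)"] by linarith
  then have "(cmod a * norm y)\<^sup>2 \<le> (norm x)\<^sup>2" by (simp add: power_mult_distrib)
  then have "cmod a * norm y \<le> norm x" by (meson norm_ge_zero power2_le_imp_le)
  then have "cmod a * norm y * norm y \<le> norm x * norm y" by (simp add: mult_right_mono)
  then show ?thesis using 1 by (simp add: power2_eq_square mult.assoc)
qed simp

lemma cinner_left_ext: "(\<And>x. cinner x y = cinner x z) \<Longrightarrow> y = (z::'a::complex_hilbert)"
proof -
  assume "\<And>x. cinner x y = cinner x z"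
  then have "cinner (y - z) (y - z) = 0" by (simp add: cinner_diff_right)
  then show "y = z" by simp
qed

lemma bounded_linear_cinner_left: "bounded_linear (\<lambda>x. cinner x (y::'a::complex_hilbert))"
  by (rule bounded_linear_intro[where K = "norm y"])
    (auto simp: cinner_add_left scaleR_eq_scaleC cinner_scaleC_left scaleR_conv_of_real cauchy_schwarz)

text \<open>Variational proof: if \<open>f\<close> is the inner product with \<open>z\<close>, then
  \<open>J\<close> below is the squared distance to \<open>z\<close> minus a constant. The
  representing vector is therefore sought as a minimiser of \<open>J\<close>.\<close>

lemma riesz:
  fixes f :: "'a::complex_hilbert \<Rightarrow> complex"
  assumes bl: "bounded_linear f" and hom: "\<And>c x. f (c *\<^sub>C x) = c * f x"
  obtains z where "\<And>x. f x = cinner x z"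
proof -
  interpret bounded_linear f by (rule bl)
  obtain K where K: "\<And>x. cmod (f x) \<le> norm x * K" using bounded by blast
  define J where "J x = (norm x)\<^sup>2 - 2 * Re (f x)" for x
  have J_lower: "- (K\<^sup>2) \<le> J x" for x
  proof -
    have "Re (f x) \<le> norm x * K" using K[of x] abs_Re_le_cmod[of "f x"] by linarith
    moreover have "0 \<le> (norm x - K)\<^sup>2" by simp
    ultimately show ?thesis by (simp add: J_def power2_diff)
  qed
  define m where "m = (INF x. J x)"
  have bdd: "bdd_below (range J)" using J_lower by (auto intro!: bdd_belowI)
  have m_le: "m \<le> J x" for x unfolding m_def by (rule cINF_lower[OF bdd]) simp
  have "\<exists>x. J x < m + 1 / real (Suc k)" for k
    using cINF_less_iff[OF _ bdd, of "m + 1 / real (Suc k)"] by (auto simp: m_def)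
  then obtain w where w: "\<And>k. J (w k) < m + 1 / real (Suc k)" by metis
  \<comment> \<open>Parallelogram law: the terms of \<open>J\<close> that are linear in the vector
    cancel. Since \<open>m\<close> bounds \<open>J\<close> at the midpoint from below, a minimising
    sequence is Cauchy.\<close>
  have par: "(norm (x - y))\<^sup>2 = 2 * (J x + J y - 2 * J ((1/2) *\<^sub>R (x + y)))" for x y
    by (simp add: J_def scaleR add norm_diff_sq norm_add_sq power_mult_distrib power_divide)
       (simp add: field_simps)
  have small: "(norm (w i - w j))\<^sup>2 < 2 * (1 / real (Suc i) + 1 / real (Suc j))" for i j
  proof -
    have "r < 2 * (c + d)" if "r = 2 * (a + b - 2 * z)" "a < m + c" "b < m + d" "m \<le> z"
      for a b c d r z :: real using that by argo
    from this[OF par w w m_le] show ?thesis .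
  qed
  have "Cauchy w"
  proof (rule CauchyI)
    fix e :: real assume e: "0 < e"
    obtain M where M: "1 / real (Suc M) < e\<^sup>2 / 4"
      using reals_Archimedean[of "e\<^sup>2 / 4"] e by (auto simp: inverse_eq_divide)
    have "norm (w i - w j) < e" if "i \<ge> M" "j \<ge> M" for i j
    proof -
      have "1 / real (Suc i) \<le> 1 / real (Suc M)" "1 / real (Suc j) \<le> 1 / real (Suc M)"
        using that by (auto simp: frac_le)
      then have "(norm (w i - w j))\<^sup>2 < e\<^sup>2" using small[of i j] M by argo
      then show ?thesis using e by (intro power2_less_imp_less[of _ e]) auto
    qed
    then show "\<exists>M. \<forall>i\<ge>M. \<forall>j\<ge>M. norm (w i - w j) < e" by blast
  qed
  then have "convergent w" by (rule Cauchy_convergent)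
  then obtain z where z: "w \<longlonglongrightarrow> z" unfolding convergent_def by blast
  have "(\<lambda>k. J (w k)) \<longlonglongrightarrow> J z" unfolding J_def
    by (intro tendsto_diff tendsto_power tendsto_norm tendsto_mult tendsto_const tendsto_Re z tendsto)
  moreover have "(\<lambda>k. m + 1 / real (Suc k)) \<longlonglongrightarrow> m + 0"
    by (intro tendsto_add tendsto_const LIMSEQ_Suc[OF lim_1_over_n])
  ultimately have "J z \<le> m + 0"
    using w by (intro LIMSEQ_le[of "\<lambda>k. J (w k)" _ "\<lambda>k. m + 1 / real (Suc k)"]) (auto intro: less_imp_le)
  then have min: "J z \<le> J x" for x using m_le[of x] by simp
  \<comment> \<open>First-order condition at the minimum \<open>z\<close>: along
    \<open>z + t *\<^sub>R x\<close> the function \<open>J\<close> changes by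
    \<open>2 * t * b + t\<^sup>2 * (norm x)\<^sup>2\<close>, so the derivative \<open>2 * b\<close>
    must vanish.\<close>
  have re: "Re (f x) = Re (cinner x z)" for x
  proof -
    define b where "b = Re (cinner z x) - Re (f x)"
    have q: "0 \<le> 2 * t * b + t\<^sup>2 * (norm x)\<^sup>2" for t :: real
    proof -
      have "Re (cinner z (t *\<^sub>R x)) = t * Re (cinner z x)"
        by (simp add: scaleR_eq_scaleC cinner_scaleC_right)
      then show ?thesis
        using min[of "z + t *\<^sub>R x"]
        by (simp add: J_def norm_add_sq add scaleR power_mult_distrib b_def algebra_simps)
    qed
    have "b = 0"
    proof (rule ccontr)
      assume "b \<noteq> 0"
      \<comment> \<open>Adding 1 keeps \<open>s\<close> positive when \<open>x = 0\<close>, while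
        the test value \<open>t = - b / s\<close> still makes the quadratic negative.\<close>
      define s where "s = (norm x)\<^sup>2 + 1"
      have s: "s > 0" by (simp add: s_def add_nonneg_pos)
      have "0 \<le> 2 * (- b / s) * b + (- b / s)\<^sup>2 * (norm x)\<^sup>2" by (rule q)
      also have "\<dots> = (b\<^sup>2 / s\<^sup>2) * ((norm x)\<^sup>2 - 2 * s)"
        using s by (simp add: field_simps power2_eq_square)
      also have "\<dots> < 0" using \<open>b \<noteq> 0\<close> s
        by (intro mult_pos_neg) (auto simp: s_def)
      finally show False by simp
    qed
    moreover have "Re (cinner z x) = Re (cinner x z)" by (subst cinner_commute) simp
    ultimately show ?thesis by (simp add: b_def)
  qed
  \<comment> \<open>The imaginary part at \<open>x\<close> is recovered from the real part at
    \<open>\<i> *\<^sub>C x\<close>.\<close>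
  have "f x = cinner x z" for x
    using re[of x] re[of "\<i> *\<^sub>C x"] by (simp add: hom cinner_scaleC_left complex_eq_iff)
  then show ?thesis by (rule that)
qed

section \<open>Adjoints\<close>

lemma bounded_opsD:
  assumes "T \<in> bounded_ops"
  shows "bounded_linear T" "T (x + y) = T x + T y" "T (c *\<^sub>C x) = c *\<^sub>C T x" "T 0 = 0"
    "T (x - y) = T x - T y"
proof -
  show bl: "bounded_linear T" "T (c *\<^sub>C x) = c *\<^sub>C T x"
    using assms by (simp_all add: bounded_ops_def)
  interpret bounded_linear T by (rule bl)
  show "T (x + y) = T x + T y" "T 0 = 0" "T (x - y) = T x - T y"
    by (rule add zero diff)+
qed

lemma adj_exists:
  assumes T: "T \<in> bounded_ops"
  obtains R where "R \<in> bounded_ops" "\<And>x y. cinner (T x) y = cinner x (R y)"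
proof -
  interpret bounded_linear T using T by (rule bounded_opsD)
  obtain K where K: "K > 0" "\<And>x. norm (T x) \<le> norm x * K" using pos_bounded by blast
  have "\<exists>z. \<forall>x. cinner (T x) y = cinner x z" for y
  proof -
    obtain z where "\<And>x. cinner (T x) y = cinner x z"
      using riesz[OF bounded_linear_compose[OF bounded_linear_cinner_left bounded_linear_axioms],
          of y thesis]
      by (simp add: bounded_opsD(3)[OF T] cinner_scaleC_left)
    then show ?thesis by blast
  qed
  then obtain R where R: "\<And>x y. cinner (T x) y = cinner x (R y)" by metis
  have Radd: "R (y + z) = R y + R z" for y z
    by (rule cinner_left_ext) (simp add: R[symmetric] cinner_add_right)
  have Rsc: "R (c *\<^sub>C y) = c *\<^sub>C R y" for c y
    by (rule cinner_left_ext) (simp add: R[symmetric] cinner_scaleC_right)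
  have Rb: "norm (R y) \<le> norm y * K" for y
  proof -
    have "(norm (R y))\<^sup>2 = cmod (cinner (T (R y)) y)"
      by (simp add: R cinner_self norm_power)
    also have "\<dots> \<le> norm (R y) * K * norm y"
      by (rule order_trans[OF cauchy_schwarz]) (simp add: K mult_right_mono)
    finally have "norm (R y) * norm (R y) \<le> norm (R y) * (norm y * K)"
      by (simp add: power2_eq_square mult_ac)
    then show ?thesis using K(1) by (cases "R y = 0") auto
  qed
  have "bounded_linear R"
    by (rule bounded_linear_intro[of _ K]) (auto simp: Radd Rsc Rb scaleR_eq_scaleC)
  then show ?thesis using that[of R] R Rsc by (auto simp: bounded_ops_def)
qed

lemma adj_eqI:
  assumes "R \<in> bounded_ops" and "\<And>x y. cinner (T x) y = cinner x (R y)"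
  shows "adj T = R"
  unfolding adj_def
proof (rule the_equality)
  fix R' assume R': "R' \<in> bounded_ops \<and> (\<forall>x y. cinner (T x) y = cinner x (R' y))"
  show "R' = R"
  proof
    fix y show "R' y = R y"
      by (rule cinner_left_ext) (metis R' assms(2))
  qed
qed (use assms in blast)

lemma
  assumes "T \<in> bounded_ops"
  shows adj_in_bounded_ops: "adj T \<in> bounded_ops"
    and cinner_adj: "cinner (T x) y = cinner x (adj T y)"
proof -
  from assms obtain R where "R \<in> bounded_ops" "\<And>x y. cinner (T x) y = cinner x (R y)"
    by (rule adj_exists) blast
  then show "adj T \<in> bounded_ops" "cinner (T x) y = cinner x (adj T y)"
    by (simp_all add: adj_eqI)
qed

lemma adj_adj: "T \<in> bounded_ops \<Longrightarrow> adj (adj T) = T"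
  by (rule adj_eqI) (simp, metis cinner_adj cinner_commute)

lemma bounded_ops_id: "id \<in> bounded_ops"
  by (simp add: bounded_ops_def id_def bounded_linear_ident)

lemma bounded_ops_comp: "R \<in> bounded_ops \<Longrightarrow> T \<in> bounded_ops \<Longrightarrow> R \<circ> T \<in> bounded_ops"
  unfolding bounded_ops_def by (simp add: o_def bounded_linear_compose)

lemma bounded_ops_add: "R \<in> bounded_ops \<Longrightarrow> T \<in> bounded_ops \<Longrightarrow> (\<lambda>x. R x + T x) \<in> bounded_ops"
  unfolding bounded_ops_def by (simp add: scaleC_add_right bounded_linear_add)

lemma bounded_ops_diff: "R \<in> bounded_ops \<Longrightarrow> T \<in> bounded_ops \<Longrightarrow> (\<lambda>x. R x - T x) \<in> bounded_ops"
  unfolding bounded_ops_def by (simp add: complex_vector.scale_right_diff_distrib bounded_linear_sub)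

lemma bounded_ops_scaleC: "T \<in> bounded_ops \<Longrightarrow> (\<lambda>x. c *\<^sub>C T x) \<in> bounded_ops"
proof -
  assume T: "T \<in> bounded_ops"
  have "bounded_linear (\<lambda>x::'a. c *\<^sub>C x)"
    by (rule bounded_linear_intro[where K = "cmod c"])
      (auto simp: scaleC_add_right scaleR_eq_scaleC scaleC_scaleC norm_scaleC mult.commute)
  from bounded_linear_compose[OF this, of T] show ?thesis using T
    unfolding bounded_ops_def by (simp add: scaleC_scaleC mult.commute)
qed

lemma adj_comp: "R \<in> bounded_ops \<Longrightarrow> T \<in> bounded_ops \<Longrightarrow> adj (R \<circ> T) = adj T \<circ> adj R"
  by (rule adj_eqI) (auto simp: cinner_adj adj_in_bounded_ops bounded_ops_comp)

lemma adj_diff: "R \<in> bounded_ops \<Longrightarrow> T \<in> bounded_ops \<Longrightarrow> adj (\<lambda>x. R x - T x) = (\<lambda>x. adj R x - adj T x)"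
  by (rule adj_eqI) (auto simp: cinner_adj adj_in_bounded_ops bounded_ops_diff cinner_diff_left cinner_diff_right)

section \<open>Partial isometries\<close>

text \<open>The inner product of \<open>T (adj T y)\<close> with \<open>y\<close> is the squared
  norm of \<open>adj T y\<close>. Hence \<open>adj T\<close> vanishes first, and then
  \<open>T\<close>.\<close>

lemma op_eq_0I:
  assumes "T \<in> bounded_ops" and "\<And>x. T (adj T x) = 0"
  shows "T x = 0"
proof -
  have "adj T y = 0" for y
    using assms cinner_adj[of T "adj T y" y] by simp
  then have "cinner (T x) (T x) = 0"
    by (simp add: cinner_adj assms)
  then show ?thesis by simp
qed

lemma orthogonal_projectionD:
  assumes "orthogonal_projection P"
  shows "P \<in> bounded_ops" "P (P x) = P x" "adj P = P"
  using assms by (auto simp: orthogonal_projection_def fun_eq_iff)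

lemma range_projection_selfadjoint:
  "V \<in> bounded_ops \<Longrightarrow> range_projection V \<in> bounded_ops"
  "V \<in> bounded_ops \<Longrightarrow> adj (range_projection V) = range_projection V"
  by (auto simp: range_projection_def bounded_ops_comp adj_in_bounded_ops adj_comp adj_adj)

lemma partial_isometryD:
  assumes "partial_isometry V"
  shows "V \<in> bounded_ops" "V (adj V (V x)) = V x" "adj V (V (adj V x)) = adj V x"
proof -
  show V: "V \<in> bounded_ops" using assms by (simp add: partial_isometry_def)
  note Va = adj_in_bounded_ops[OF V]
  have Q: "V (adj V (V (adj V x))) = V (adj V x)" for x
    using assms by (auto simp: partial_isometry_def range_projection_def
        dest: orthogonal_projectionD(2))
  \<comment> \<open>For the idempotent \<open>Q = V \<circ> adj V\<close>, the product of
    \<open>W\<close> and its adjoint is \<open>Q^3 - 2 Q^2 + Q = 0\<close>, so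
    \<open>op_eq_0I\<close> applies to \<open>W\<close>.\<close>
  define W where "W x = V (adj V (V x)) - V x" for x
  have W_eq: "W = (\<lambda>x. (V \<circ> adj V \<circ> V) x - V x)"
    by (simp add: W_def fun_eq_iff)
  have VVV: "V \<circ> adj V \<circ> V \<in> bounded_ops" by (intro bounded_ops_comp V Va)
  have W: "W \<in> bounded_ops"
    unfolding W_eq by (intro bounded_ops_diff VVV V)
  have "adj W = (\<lambda>x. adj (V \<circ> adj V \<circ> V) x - adj V x)"
    unfolding W_eq by (rule adj_diff[OF VVV V])
  then have adj_W: "adj W = (\<lambda>x. adj V (V (adj V x)) - adj V x)"
    by (simp add: adj_comp adj_adj V Va bounded_ops_comp)
  have "W x = 0" for x
    by (rule op_eq_0I[OF W]) (simp add: adj_W W_def bounded_opsD(4,5)[OF V] bounded_opsD(4,5)[OF Va] Q)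
  then have 1: "V (adj V (V x)) = V x" for x by (simp add: W_def)
  then show "V (adj V (V x)) = V x" .
  show "adj V (V (adj V x)) = adj V x"
  proof (rule cinner_left_ext)
    fix z
    show "cinner z (adj V (V (adj V x))) = cinner z (adj V x)"
      by (metis 1 V Va adj_adj cinner_adj)
  qed
qed

text \<open>The range projection of any bounded operator is self-adjoint, so idempotence is the only
  condition left.\<close>

lemma partial_isometryI:
  assumes "V \<in> bounded_ops" and "\<And>x. V (adj V (V (adj V x))) = V (adj V x)"
  shows "partial_isometry V"
  using assms range_projection_selfadjoint[OF assms(1)]
  by (auto simp: partial_isometry_def orthogonal_projection_def range_projection_def fun_eq_iff)

lemma partial_isometry_adj: "partial_isometry V \<Longrightarrow> partial_isometry (adj V)"
  by (rule partial_isometryI) (simp_all add: adj_in_bounded_ops adj_adj partial_isometryD)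

text \<open>Together with \<open>initial_commutes_range\<close> this is the classical criterion: a
  product of partial isometries is again one exactly when the initial projection of the left factor
  commutes with the final projection of the right factor.\<close>

lemma partial_isometry_comp:
  assumes A: "partial_isometry A" and B: "partial_isometry B"
    and comm: "\<And>x. adj A (A (B (adj B x))) = B (adj B (adj A (A x)))"
  shows "partial_isometry (A \<circ> B)"
proof (rule partial_isometryI)
  note A' = partial_isometryD[OF A] and B' = partial_isometryD[OF B]
  show "A \<circ> B \<in> bounded_ops" using A' B' by (simp add: bounded_ops_comp)
  show "(A \<circ> B) (adj (A \<circ> B) ((A \<circ> B) (adj (A \<circ> B) x))) = (A \<circ> B) (adj (A \<circ> B) x)" for x
    by (simp add: adj_comp A'(1) B'(1) comm A'(3) B'(3))
qed

lemma initial_commutes_range: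
  assumes V: "partial_isometry V" and B: "partial_isometry B" and VB: "partial_isometry (V \<circ> B)"
  shows "adj V (V (B (adj B x))) = B (adj B (adj V (V x)))"
proof -
  note V' = partial_isometryD[OF V] and B' = partial_isometryD[OF B] and VB' = partial_isometryD[OF VB]
  define E where "E = adj V \<circ> V"
  define F where "F = B \<circ> adj B"
  have E: "E \<in> bounded_ops" "adj E = E" "\<And>x. E (E x) = E x"
    using V' by (auto simp: E_def bounded_ops_comp adj_in_bounded_ops adj_comp adj_adj)
  have F: "F \<in> bounded_ops" "adj F = F" "\<And>x. F (F x) = F x"
    using B' by (auto simp: F_def bounded_ops_comp adj_in_bounded_ops adj_comp adj_adj)
  have s: "cinner (E u) w = cinner u (E w)" "cinner (F u) w = cinner u (F w)" for u w
    using cinner_adj[OF E(1)] cinner_adj[OF F(1)] E(2) F(2) by auto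
  have EFEFE: "E (F (E (F (E x)))) = E (F (E x))" for x
    using VB'(2)[of "adj B (adj V (V x))"]
    by (simp add: E_def F_def adj_comp V' B')
  \<comment> \<open>\<open>EFE\<close> idempotent means \<open>(1 - E)FE\<close> has modulus square \<open>EFE - EFEFE = 0\<close>.\<close>
  have FE: "F (E x) = E (F (E x))" for x
  proof -
    have "cinner (F (E x) - E (F (E x))) (F (E x) - E (F (E x))) = 0"
      by (simp add: cinner_diff_left cinner_diff_right s E(3) F(3) EFEFE)
    then show ?thesis by simp
  qed
  \<comment> \<open>\<open>FE = EFE\<close> has a self-adjoint right-hand side, so taking adjoints
    gives \<open>EF = EFE = FE\<close>.\<close>
  have "E (F x) = F (E x)"
  proof (rule cinner_left_ext)
    fix z
    show "cinner z (E (F x)) = cinner z (F (E x))"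
      by (metis FE s)
  qed
  then show ?thesis by (simp add: E_def F_def)
qed

section \<open>Von Neumann algebras\<close>

lemma topspace_wot: "topspace weak_operator_topology = bounded_ops"
  by (simp add: weak_operator_topology_def topspace_pullback_topology)

lemma continuous_map_wot_cinner:
  "continuous_map weak_operator_topology euclidean (\<lambda>X. cinner (X a) b)"
proof -
  have "continuous_map euclidean euclidean (\<lambda>f. f (a, b) :: complex)"
    by (simp add: continuous_on_coordinatewise_then_product continuous_on_product_coordinates)
  from continuous_map_pullback[OF this, of bounded_ops "\<lambda>T. \<lambda>(x, y). cinner (T x) y"]
  show ?thesis by (simp add: weak_operator_topology_def o_def)
qed

text \<open>The weak operator topology is initial for the matrix coefficients, so continuity of a
  map into it can be tested on them.\<close>

lemma continuous_map_wot_into: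
  assumes "\<And>X. X \<in> bounded_ops \<Longrightarrow> g X \<in> bounded_ops"
    and "\<And>x y. continuous_map weak_operator_topology euclidean (\<lambda>X. cinner (g X x) y)"
  shows "continuous_map weak_operator_topology weak_operator_topology g"
proof -
  have "continuous_map weak_operator_topology euclidean (\<lambda>X. \<lambda>(x, y). cinner (g X x) y)"
    using assms(2) unfolding euclidean_product_topology[symmetric]
    by (auto simp: continuous_map_componentwise_UNIV)
  then have "continuous_map weak_operator_topology weak_operator_topology g"
    by (subst (2) weak_operator_topology_def, intro continuous_map_pullback')
      (auto simp: o_def topspace_wot assms(1))
  then show ?thesis .
qed

text \<open>The free maps \<open>a\<close>, \<open>b\<close>, \<open>c\<close>, \<open>d\<close>
  allow commutation of \<open>X\<close> with a self-adjoint operator to be expressed by matrix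
  coefficients of \<open>X\<close> alone, with that operator moved to the second argument on one
  side.\<close>

lemma closedin_wot_cinner_eq:
  "closedin weak_operator_topology {X \<in> bounded_ops. \<forall>x y. cinner (X (a x)) (b y) = cinner (X (c x)) (d y)}"
proof -
  have "closedin weak_operator_topology
      {X \<in> topspace weak_operator_topology. cinner (X (a x)) (b y) = cinner (X (c x)) (d y)}" for x y
    by (intro closedin_continuous_maps_eq[OF Hausdorff_space_euclidean] continuous_map_wot_cinner)
  then have "closedin weak_operator_topology
      (\<Inter>x. \<Inter>y. {X \<in> bounded_ops. cinner (X (a x)) (b y) = cinner (X (c x)) (d y)})"
    by (intro closedin_INT) (auto simp: topspace_wot)
  moreover have "(\<Inter>x. \<Inter>y. {X \<in> bounded_ops. cinner (X (a x)) (b y) = cinner (X (c x)) (d y)}) =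
      {X \<in> bounded_ops. \<forall>x y. cinner (X (a x)) (b y) = cinner (X (c x)) (d y)}" by auto
  ultimately show ?thesis by simp
qed

lemma von_neumann_algebra_bounded_ops: "von_neumann_algebra (bounded_ops :: ('a::complex_hilbert \<Rightarrow> 'a) set)"
  unfolding von_neumann_algebra_def topspace_wot[symmetric]
  by (simp only: closedin_topspace) (simp add: topspace_wot bounded_ops_id bounded_ops_add
      bounded_ops_scaleC bounded_ops_comp adj_in_bounded_ops)

lemma von_neumann_algebra_generated_vN:
  assumes "A \<subseteq> bounded_ops"
  shows "von_neumann_algebra (generated_vN A)"
proof -
  \<comment> \<open>An empty family would have intersection \<open>UNIV\<close>;
    \<open>bounded_ops\<close> is a member.\<close>
  have ne: "{M. von_neumann_algebra M \<and> A \<subseteq> M} \<noteq> {}"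
    using assms von_neumann_algebra_bounded_ops by blast
  have "closedin weak_operator_topology (generated_vN A)"
    unfolding generated_vN_def
    by (rule closedin_Inter[OF ne]) (auto simp: von_neumann_algebra_def)
  moreover have "generated_vN A \<subseteq> bounded_ops"
    using assms von_neumann_algebra_bounded_ops by (auto simp: generated_vN_def)
  ultimately show ?thesis
    unfolding von_neumann_algebra_def by (auto simp: generated_vN_def von_neumann_algebra_def)
qed

lemma generated_vN_superset: "A \<subseteq> generated_vN A"
  by (auto simp: generated_vN_def)

lemma generated_vN_least: "von_neumann_algebra M \<Longrightarrow> A \<subseteq> M \<Longrightarrow> generated_vN A \<subseteq> M"
  by (auto simp: generated_vN_def)

text \<open>Serves as an induction principle: a property of the generators extends to the generated
  algebra. Conjugation by \<open>V\<close> alone is not multiplicative; commuting with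
  \<open>adj V \<circ> V\<close> makes it so, because the inner factor
  \<open>adj V \<circ> V\<close> can be moved out to the left, where \<open>V\<close> absorbs
  it.\<close>

lemma von_neumann_algebra_conj_commutant:
  assumes N: "von_neumann_algebra N" and V: "partial_isometry V" and Q: "range_projection V \<in> N"
  shows "von_neumann_algebra {X \<in> bounded_ops. V \<circ> X \<circ> adj V \<in> N \<and>
    (\<forall>x. X (adj V (V x)) = adj V (V (X x)))}" (is "von_neumann_algebra ?M")
proof -
  note V' = partial_isometryD[OF V] and Va = adj_in_bounded_ops[OF partial_isometryD(1)[OF V]]
  have N': "id \<in> N" "\<And>R T. R \<in> N \<Longrightarrow> T \<in> N \<Longrightarrow> (\<lambda>x. R x + T x) \<in> N"
     "\<And>c T. T \<in> N \<Longrightarrow> (\<lambda>x. c *\<^sub>C T x) \<in> N" "\<And>R T. R \<in> N \<Longrightarrow> T \<in> N \<Longrightarrow> R \<circ> T \<in> N"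
     "\<And>T. T \<in> N \<Longrightarrow> adj T \<in> N" "closedin weak_operator_topology N"
    using N by (auto simp: von_neumann_algebra_def)
  note lin = bounded_opsD(2,3)[OF V'(1)] bounded_opsD(2,3)[OF Va]
  have cont: "continuous_map weak_operator_topology weak_operator_topology (\<lambda>X. V \<circ> X \<circ> adj V)"
  proof (rule continuous_map_wot_into)
    show "V \<circ> X \<circ> adj V \<in> bounded_ops" if "X \<in> bounded_ops" for X
      by (intro bounded_ops_comp V' Va that)
    show "continuous_map weak_operator_topology euclidean (\<lambda>X. cinner ((V \<circ> X \<circ> adj V) x) y)" for x y
      using continuous_map_wot_cinner[of "adj V x" "adj V y"] by (simp add: cinner_adj V')
  qed
  \<comment> \<open>Rewrites commutation in the form whose solution set is known to be weakly
    closed.\<close>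
  have comm_iff: "(\<forall>x. X (adj V (V x)) = adj V (V (X x))) \<longleftrightarrow>
      (\<forall>x y. cinner (X (adj V (V x))) y = cinner (X x) (adj V (V y)))" for X
  proof -
    have "cinner (adj V (V (X x))) y = cinner (X x) (adj V (V y))" for x y
      by (metis V'(1) Va adj_adj cinner_adj)
    moreover have "u = w" if "\<And>y. cinner u y = cinner w y" for u w :: 'a
      using that by (metis cinner_left_ext cinner_commute)
    ultimately show ?thesis by metis
  qed
  have "closedin weak_operator_topology ({X \<in> topspace weak_operator_topology. V \<circ> X \<circ> adj V \<in> N} \<inter>
      {X \<in> bounded_ops. \<forall>x y. cinner (X (adj V (V x))) y = cinner (X x) (adj V (V y))})"
    by (intro closedin_Int closedin_continuous_map_preimage[OF cont] N' closedin_wot_cinner_eq)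
  also have "\<dots> = ?M" by (auto simp: topspace_wot comm_iff)
  finally have closed: "closedin weak_operator_topology ?M" .
  have id: "V \<circ> adj V \<in> N" using Q by (simp add: range_projection_def)
  have add: "V \<circ> (\<lambda>x. R x + T x) \<circ> adj V \<in> N" if "V \<circ> R \<circ> adj V \<in> N" "V \<circ> T \<circ> adj V \<in> N" for R T
    using N'(2)[OF that] by (simp add: o_def lin)
  have sc: "V \<circ> (\<lambda>x. c *\<^sub>C T x) \<circ> adj V \<in> N" if "V \<circ> T \<circ> adj V \<in> N" for c T
    using N'(3)[OF that, of c] by (simp add: o_def lin)
  have mult: "V \<circ> (R \<circ> T) \<circ> adj V \<in> N" if "V \<circ> R \<circ> adj V \<in> N" "V \<circ> T \<circ> adj V \<in> N"
    and "\<forall>x. R (adj V (V x)) = adj V (V (R x))" for R T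
    using N'(4)[OF that(1,2)] that(3) V'(2) by (simp add: o_def)
  have adj: "V \<circ> adj T \<circ> adj V \<in> N" "adj T (adj V (V x)) = adj V (V (adj T x))"
    if T: "T \<in> bounded_ops" "V \<circ> T \<circ> adj V \<in> N" "\<forall>x. T (adj V (V x)) = adj V (V (T x))" for T x
  proof -
    show "V \<circ> adj T \<circ> adj V \<in> N"
      using N'(5)[OF T(2)] T(1) V' Va by (simp add: adj_comp adj_adj bounded_ops_comp o_assoc)
    have "cinner z (adj T (adj V (V x))) = cinner z (adj V (V (adj T x)))" for z
      by (metis T(1,3) V'(1) Va adj_adj cinner_adj)
    then show "adj T (adj V (V x)) = adj V (V (adj T x))" by (rule cinner_left_ext)
  qed
  show ?thesis
    unfolding von_neumann_algebra_def
    by (safe intro!: closed)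
      (simp_all add: bounded_ops_id bounded_ops_add bounded_ops_scaleC bounded_ops_comp
        adj_in_bounded_ops id add sc mult adj lin)
qed

section \<open>Matrix units in full matrix algebras\<close>

text \<open>The statement inside one fibre. An \<open>n\<close> by \<open>n\<close> system of matrix
  units made of matrices of the same size \<open>n\<close> either vanishes or is similar to the
  standard one, and then only scalars commute with it. The assumption \<open>unit\<close> forces
  \<open>z\<close> to vanish in the first case.\<close>

lemma commutes_with_matrix_units_imp_scalar:
  fixes f :: "nat \<Rightarrow> nat \<Rightarrow> nat \<Rightarrow> nat \<Rightarrow> complex" and z :: "nat \<Rightarrow> nat \<Rightarrow> complex"
  assumes mult: "\<And>k l r s i j. \<lbrakk>k < n; l < n; r < n; s < n; i < n; j < n\<rbrakk> \<Longrightarrow>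
      (\<Sum>m<n. f k l i m * f r s m j) = (if l = r then f k s i j else 0)"
    and comm: "\<And>k l i j. \<lbrakk>k < n; l < n; i < n; j < n\<rbrakk> \<Longrightarrow>
      (\<Sum>m<n. z i m * f k l m j) = (\<Sum>m<n. f k l i m * z m j)"
    and unit: "\<And>i j. \<lbrakk>i < n; j < n\<rbrakk> \<Longrightarrow> z i j = (\<Sum>k<n. \<Sum>m<n. z i m * f k k m j)"
    and ij: "i < n" "j < n"
  shows "z i j = (if i = j then z 0 0 else 0)"
proof (cases "\<forall>r<n. \<forall>q<n. f 0 0 r q = 0")
  \<comment> \<open>\<open>f 0 0 = 0\<close> propagates through \<open>f k 0 = f k 0 f 0 0\<close>
    to \<open>f k k = f k 0 f 0 k\<close>.\<close>
  case True
  have n: "0 < n" using ij by simp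
  have k0: "f k 0 r q = 0" if "k < n" "r < n" "q < n" for k r q
    using mult[of k 0 0 0 r q] that n True by simp
  have "f k k r q = 0" if "k < n" "r < n" "q < n" for k r q
    using mult[of k 0 0 k r q] that n k0 by simp
  then have "z r q = 0" if "r < n" "q < n" for r q
    using unit[OF that] that by simp
  then show ?thesis using ij n by simp
next
  case False
  then obtain r q where rq: "r < n" "q < n" and a: "f 0 0 r q \<noteq> 0" by blast
  have n: "0 < n" using ij by simp
  define a where "a = f 0 0 r q"
  have a0: "a \<noteq> 0" using a by (simp add: a_def)
  \<comment> \<open>The columns of \<open>B\<close> are column \<open>q\<close> of each
    \<open>f i 0\<close>, and the rows of \<open>L\<close> are row \<open>r\<close> of each
    \<open>f 0 k\<close>, scaled by \<open>1 / a\<close>. The multiplication table makes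
    \<open>L\<close> a left inverse of \<open>B\<close>.\<close>
  define B where "B = Matrix.mat n n (\<lambda>(s, i). f i 0 s q)"
  define L where "L = Matrix.mat n n (\<lambda>(k, t). f 0 k r t / a)"
  have "L * B = 1\<^sub>m n"
  proof (rule eq_matI)
    fix k i assume "k < dim_row (1\<^sub>m n)" "i < dim_col (1\<^sub>m n)"
    then have ki: "k < n" "i < n" by auto
    have "(L * B) $$ (k, i) = (\<Sum>t<n. f 0 k r t / a * f i 0 t q)"
      using ki by (simp add: L_def B_def scalar_prod_def lessThan_atLeast0)
    also have "\<dots> = (\<Sum>t<n. f 0 k r t * f i 0 t q) / a"
      by (simp add: sum_divide_distrib)
    also have "\<dots> = 1\<^sub>m n $$ (k, i)"
      using ki rq n a0 by (simp add: mult a_def)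
    finally show "(L * B) $$ (k, i) = 1\<^sub>m n $$ (k, i)" .
  qed (auto simp: L_def B_def)
  \<comment> \<open>A left inverse of a square matrix is also a right inverse. \<open>B\<close> is
    square because the number of units in a column of the system equals the size of the
    matrices.\<close>
  then have BL: "B * L = 1\<^sub>m n"
    by (rule mat_mult_left_right_inverse[rotated 2]) (auto simp: L_def B_def)
  have star: "(\<Sum>k<n. f k 0 s q * f 0 k r t) = (if s = t then a else 0)" if "s < n" "t < n" for s t
  proof -
    have "(\<Sum>k<n. f k 0 s q * f 0 k r t) / a = (B * L) $$ (s, t)"
      using that by (simp add: L_def B_def scalar_prod_def lessThan_atLeast0 sum_divide_distrib)
    then show ?thesis using that a0 by (simp add: BL split: if_splits)
  qed
  \<comment> \<open>Inserting the resolution \<open>star\<close> of the identity exhibits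
    \<open>f k 0\<close> as a rank-one matrix, a column times a row.\<close>
  have rank1: "a * f k 0 s t = f k 0 s q * f 0 0 r t" if k: "k < n" "s < n" "t < n" for k s t
  proof -
    have "a * f k 0 s t = (\<Sum>m<n. f k 0 s m * (if m = t then a else 0))"
      using k by (simp add: if_distrib cong: if_cong)
    also have "\<dots> = (\<Sum>m<n. f k 0 s m * (\<Sum>l<n. f l 0 m q * f 0 l r t))"
      using k by (intro sum.cong) (auto simp: star)
    also have "\<dots> = (\<Sum>m<n. \<Sum>l<n. f k 0 s m * f l 0 m q * f 0 l r t)"
      by (simp add: sum_distrib_left mult.assoc)
    also have "\<dots> = (\<Sum>l<n. (\<Sum>m<n. f k 0 s m * f l 0 m q) * f 0 l r t)"
      by (subst sum.swap) (simp add: sum_distrib_right)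
    also have "\<dots> = (\<Sum>l<n. if l = 0 then f k 0 s q * f 0 0 r t else 0)"
      using k rq n by (intro sum.cong) (auto simp: mult)
    also have "\<dots> = f k 0 s q * f 0 0 r t" using n by simp
    finally show ?thesis .
  qed
  define \<zeta> where "\<zeta> = (\<Sum>t<n. f 0 0 r t * z t q)"
  \<comment> \<open>Column \<open>q\<close> of \<open>f k 0\<close> is an eigenvector of
    \<open>z\<close> for the eigenvalue \<open>\<zeta> / a\<close>, the same for every
    \<open>k\<close>. By \<open>star\<close> these columns span the space, so \<open>z\<close> is
    scalar.\<close>
  have zf: "a * (\<Sum>m<n. z s m * f k 0 m q) = f k 0 s q * \<zeta>" if k: "k < n" "s < n" for k s
  proof -
    have "a * (\<Sum>m<n. z s m * f k 0 m q) = (\<Sum>m<n. a * f k 0 s m * z m q)"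
      using k rq n by (simp add: comm sum_distrib_left mult.assoc)
    also have "\<dots> = (\<Sum>m<n. f k 0 s q * f 0 0 r m * z m q)"
      using k by (intro sum.cong) (auto simp: rank1)
    finally show ?thesis by (simp add: \<zeta>_def sum_distrib_left mult.assoc)
  qed
  have "z s t = (if s = t then \<zeta> / a else 0)" if s: "s < n" "t < n" for s t
  proof -
    have "a * z s t = (\<Sum>m<n. z s m * (if m = t then a else 0))"
      using s by (simp add: if_distrib cong: if_cong)
    also have "\<dots> = (\<Sum>m<n. z s m * (\<Sum>k<n. f k 0 m q * f 0 k r t))"
      using s by (intro sum.cong) (auto simp: star)
    also have "\<dots> = (\<Sum>m<n. \<Sum>k<n. z s m * f k 0 m q * f 0 k r t)"
      by (simp add: sum_distrib_left mult.assoc)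
    also have "\<dots> = (\<Sum>k<n. (\<Sum>m<n. z s m * f k 0 m q) * f 0 k r t)"
      by (subst sum.swap) (simp add: sum_distrib_right)
    finally have "a * (a * z s t) = a * (\<Sum>k<n. (\<Sum>m<n. z s m * f k 0 m q) * f 0 k r t)"
      by simp
    also have "\<dots> = (\<Sum>k<n. a * (\<Sum>m<n. z s m * f k 0 m q) * f 0 k r t)"
      by (subst sum_distrib_left) (simp add: mult.assoc)
    also have "\<dots> = (\<Sum>k<n. \<zeta> * (f k 0 s q * f 0 k r t))"
      using s by (intro sum.cong) (auto simp: zf)
    also have "\<dots> = \<zeta> * (if s = t then a else 0)"
      using s by (simp add: sum_distrib_left[symmetric] star)
    finally show ?thesis using a0 by (auto simp: field_simps)
  qed
  then show ?thesis using ij n by simp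
qed

section \<open>Multiplication operators on a finite sum of function spaces\<close>

text \<open>Coordinates for a unitary from \<open>'a\<close> onto the square-integrable functions
  with values in complex \<open>n\<close>-space: \<open>norm_sq_coord\<close> is isometry and
  \<open>coord_surj\<close> surjectivity. \<open>c v i\<close> is a chosen representative of a
  class, so linearity holds only almost everywhere. Finiteness of \<open>\<mu>\<close> makes bounded
  measurable functions square-integrable.\<close>

locale coordinate_model = finite_measure \<mu> for \<mu> :: "'m measure" +
  fixes n :: nat and c :: "'a::complex_hilbert \<Rightarrow> nat \<Rightarrow> 'm \<Rightarrow> complex"
  assumes n_pos: "0 < n"
    and coord_measurable [measurable]: "c v i \<in> borel_measurable \<mu>"
    and coord_add: "i < n \<Longrightarrow> AE p in \<mu>. c (v + w) i p = c v i p + c w i p"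
    and coord_scaleC: "i < n \<Longrightarrow> AE p in \<mu>. c (a *\<^sub>C v) i p = a * c v i p"
    and coord_integrable: "i < n \<Longrightarrow> integrable \<mu> (\<lambda>p. (cmod (c v i p))\<^sup>2)"
    and norm_sq_coord: "(norm v)\<^sup>2 = (\<Sum>i<n. LINT p|\<mu>. (cmod (c v i p))\<^sup>2)"
    and coord_surj: "\<lbrakk>\<And>i. i < n \<Longrightarrow> f i \<in> borel_measurable \<mu>;
      \<And>i. i < n \<Longrightarrow> integrable \<mu> (\<lambda>p. (cmod (f i p))\<^sup>2)\<rbrakk> \<Longrightarrow>
      \<exists>v. \<forall>i<n. AE p in \<mu>. c v i p = f i p"
begin

definition mult_ops :: "('a \<Rightarrow> 'a) set" where
  "mult_ops = {T \<in> bounded_ops. \<exists>\<phi>. \<phi> \<in> borel_measurable \<mu> \<and> (\<exists>K. AE p in \<mu>. cmod (\<phi> p) \<le> K) \<and>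
     (\<forall>v. \<forall>i<n. AE p in \<mu>. c (T v) i p = \<phi> p * c v i p)}"

lemma mult_opsE:
  assumes "T \<in> mult_ops"
  obtains \<phi> where "T \<in> bounded_ops" "\<phi> \<in> borel_measurable \<mu>"
    "\<And>v i. i < n \<Longrightarrow> AE p in \<mu>. c (T v) i p = \<phi> p * c v i p"
  using assms unfolding mult_ops_def by blast

lemma coord_ext:
  assumes "\<And>i. i < n \<Longrightarrow> AE p in \<mu>. c v i p = c w i p"
  shows "v = w"
proof -
  have "(LINT p|\<mu>. (cmod (c (v + (-1) *\<^sub>C w) i p))\<^sup>2) = 0" if i: "i < n" for i
  proof -
    have "AE p in \<mu>. (cmod (c (v + (-1) *\<^sub>C w) i p))\<^sup>2 = 0"
      using assms[OF i] coord_add[OF i, of v "(-1) *\<^sub>C w"] coord_scaleC[OF i, of "-1" w]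
      by eventually_elim simp
    then show ?thesis by (rule integral_eq_zero_AE)
  qed
  then have "(norm (v + (-1) *\<^sub>C w))\<^sup>2 = 0" by (simp add: norm_sq_coord)
  then show ?thesis by (simp add: complex_vector.scale_minus_left scaleC_one)
qed

lemma coord_0: "i < n \<Longrightarrow> AE p in \<mu>. c 0 i p = 0"
  using coord_scaleC[of i 0 0] by simp

lemma coord_sum:
  assumes "finite A" and i: "i < n"
  shows "AE p in \<mu>. c (\<Sum>j\<in>A. f j) i p = (\<Sum>j\<in>A. c (f j) i p)"
  using assms(1)
proof (induction A rule: finite_induct)
  case (insert x F)
  show ?case
    using coord_add[OF i, of "f x" "sum f F"] insert.IH by eventually_elim (simp add: insert.hyps)
qed (simp add: coord_0 i)

lemma AE_all_less:
  assumes "\<And>i. i < (m::nat) \<Longrightarrow> AE p in \<mu>. R i p"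
  shows "AE p in \<mu>. \<forall>i<m. R i p"
  using AE_finite_allI[of "{..<m}" R \<mu>] assms by auto

definition vec_of :: "(nat \<Rightarrow> 'm \<Rightarrow> complex) \<Rightarrow> 'a" where
  "vec_of f = (SOME v. \<forall>i<n. AE p in \<mu>. c v i p = f i p)"

lemma coord_vec_of:
  assumes "\<And>i. i < n \<Longrightarrow> f i \<in> borel_measurable \<mu>"
    "\<And>i. i < n \<Longrightarrow> integrable \<mu> (\<lambda>p. (cmod (f i p))\<^sup>2)" "i < n"
  shows "AE p in \<mu>. c (vec_of f) i p = f i p"
  using someI_ex[OF coord_surj[of f, OF assms(1,2)]] assms(3) by (simp add: vec_of_def)

section \<open>Multiplication by bounded measurable functions\<close>

definition mult_op :: "('m \<Rightarrow> complex) \<Rightarrow> 'a \<Rightarrow> 'a" where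
  "mult_op \<phi> v = vec_of (\<lambda>i p. \<phi> p * c v i p)"

lemma integrable_bounded_mult:
  assumes [measurable]: "\<phi> \<in> borel_measurable \<mu>" and K: "\<And>p. cmod (\<phi> p) \<le> K" and i: "i < n"
  shows "integrable \<mu> (\<lambda>p. (cmod (\<phi> p * c v i p))\<^sup>2)"
proof (rule Bochner_Integration.integrable_bound)
  show "integrable \<mu> (\<lambda>p. K\<^sup>2 * (cmod (c v i p))\<^sup>2)" using coord_integrable[OF i] by simp
  show "AE p in \<mu>. norm ((cmod (\<phi> p * c v i p))\<^sup>2) \<le> norm (K\<^sup>2 * (cmod (c v i p))\<^sup>2)"
    using K by (auto simp: norm_mult power_mult_distrib intro!: mult_right_mono power_mono)
qed simp

lemma coord_mult_op:
  assumes "\<phi> \<in> borel_measurable \<mu>" "\<And>p. cmod (\<phi> p) \<le> K" "i < n"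
  shows "AE p in \<mu>. c (mult_op \<phi> v) i p = \<phi> p * c v i p"
  unfolding mult_op_def
  by (rule coord_vec_of) (use assms in \<open>auto intro: integrable_bounded_mult\<close>)

lemma mult_op_in_mult_ops:
  assumes [measurable]: "\<phi> \<in> borel_measurable \<mu>" and K: "\<And>p. cmod (\<phi> p) \<le> K"
  shows "mult_op \<phi> \<in> mult_ops"
proof -
  note cm = coord_mult_op[OF assms]
  \<comment> \<open>The bound holds at every point of the type, so any point shows that
    \<open>K\<close> is nonnegative; this is needed to take roots in the norm estimate.\<close>
  have K0: "0 \<le> K" using K[of undefined] norm_ge_zero order_trans by blast
  have add: "mult_op \<phi> (v + w) = mult_op \<phi> v + mult_op \<phi> w" for v w
  proof (rule coord_ext)
    fix i assume i: "i < n"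
    show "AE p in \<mu>. c (mult_op \<phi> (v + w)) i p = c (mult_op \<phi> v + mult_op \<phi> w) i p"
      using cm[OF i, of "v + w"] cm[OF i, of v] cm[OF i, of w] coord_add[OF i, of v w]
        coord_add[OF i, of "mult_op \<phi> v" "mult_op \<phi> w"]
      by eventually_elim (simp add: algebra_simps)
  qed
  have scale: "mult_op \<phi> (a *\<^sub>C v) = a *\<^sub>C mult_op \<phi> v" for a v
  proof (rule coord_ext)
    fix i assume i: "i < n"
    show "AE p in \<mu>. c (mult_op \<phi> (a *\<^sub>C v)) i p = c (a *\<^sub>C mult_op \<phi> v) i p"
      using cm[OF i, of "a *\<^sub>C v"] cm[OF i, of v] coord_scaleC[OF i, of a v]
        coord_scaleC[OF i, of a "mult_op \<phi> v"]
      by eventually_elim (simp add: algebra_simps)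
  qed
  have bound: "norm (mult_op \<phi> v) \<le> norm v * K" for v
  proof -
    have "(LINT p|\<mu>. (cmod (c (mult_op \<phi> v) i p))\<^sup>2) \<le> (LINT p|\<mu>. K\<^sup>2 * (cmod (c v i p))\<^sup>2)"
      if i: "i < n" for i
    proof (rule integral_mono_AE)
      show "AE p in \<mu>. (cmod (c (mult_op \<phi> v) i p))\<^sup>2 \<le> K\<^sup>2 * (cmod (c v i p))\<^sup>2"
        using cm[OF i, of v]
        by eventually_elim (auto simp: norm_mult power_mult_distrib intro!: mult_right_mono power_mono K)
    qed (simp_all add: coord_integrable i)
    then have "(norm (mult_op \<phi> v))\<^sup>2 \<le> (\<Sum>i<n. LINT p|\<mu>. K\<^sup>2 * (cmod (c v i p))\<^sup>2)"
      unfolding norm_sq_coord by (intro sum_mono) auto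
    also have "\<dots> = (norm v * K)\<^sup>2"
      by (simp add: norm_sq_coord power_mult_distrib sum_distrib_left mult.commute)
    finally show ?thesis using K0 by (meson mult_nonneg_nonneg norm_ge_zero power2_le_imp_le)
  qed
  have "bounded_linear (mult_op \<phi>)"
    by (rule bounded_linear_intro[of _ K]) (simp_all add: add scale scaleR_eq_scaleC bound)
  then have "mult_op \<phi> \<in> bounded_ops" by (simp add: bounded_ops_def scale)
  then show ?thesis unfolding mult_ops_def using cm assms by blast
qed

lemma id_in_mult_ops: "id \<in> mult_ops"
  unfolding mult_ops_def
  by (auto simp: bounded_ops_id intro!: exI[of _ "\<lambda>_. 1"] exI[of _ 1])

lemma mult_ops_commute:
  assumes "R \<in> mult_ops" "T \<in> mult_ops"
  shows "R (T v) = T (R v)"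
proof (rule coord_ext)
  fix i assume i: "i < n"
  obtain \<phi> \<psi> where \<phi>: "\<And>v. AE p in \<mu>. c (R v) i p = \<phi> p * c v i p"
    and \<psi>: "\<And>v. AE p in \<mu>. c (T v) i p = \<psi> p * c v i p"
    using assms i by (metis mult_opsE)
  show "AE p in \<mu>. c (R (T v)) i p = c (T (R v)) i p"
    using \<phi>[of v] \<phi>[of "T v"] \<psi>[of v] \<psi>[of "R v"] by eventually_elim simp
qed

text \<open>The commutant of \<open>mult_ops\<close> among additive maps. Complex homogeneity is
  implied, since multiplication by a constant belongs to \<open>mult_ops\<close>.\<close>

definition commuting :: "('a \<Rightarrow> 'a) \<Rightarrow> bool" where
  "commuting X \<longleftrightarrow> (\<forall>v w. X (v + w) = X v + X w) \<and> (\<forall>T\<in>mult_ops. \<forall>v. X (T v) = T (X v))"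

lemma commuting_sum: "commuting X \<Longrightarrow> X (\<Sum>j<k. f j) = (\<Sum>j<k::nat. X (f j))"
proof (induction k)
  case 0
  then have "X (0 + 0) = X 0 + X 0" unfolding commuting_def by blast
  then show ?case by simp
qed (simp add: commuting_def)

definition unit_vec :: "nat \<Rightarrow> 'a" where
  "unit_vec j = vec_of (\<lambda>i p. if i = j then 1 else 0)"

lemma coord_unit_vec: "i < n \<Longrightarrow> AE p in \<mu>. c (unit_vec j) i p = (if i = j then 1 else 0)"
  unfolding unit_vec_def by (rule coord_vec_of) auto

text \<open>In each fibre \<open>X\<close> acts by the matrix whose columns are the coordinates of
  \<open>X (unit_vec j)\<close>. The coordinates of \<open>v\<close> may be unbounded and then give
  no multiplication operators, so \<open>v\<close> is first damped by a nowhere vanishing factor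
  \<open>\<psi>\<close>. The damped vector is a combination of the \<open>unit_vec j\<close> with
  bounded coefficients \<open>g j\<close>; these pass through \<open>X\<close>, and
  \<open>\<psi>\<close> is cancelled at the end.\<close>

lemma commuting_decomposable:
  assumes X: "commuting X" and i: "i < n"
  shows "AE p in \<mu>. c (X v) i p = (\<Sum>j<n. c (X (unit_vec j)) i p * c v j p)"
proof -
  define \<psi> :: "'m \<Rightarrow> complex" where "\<psi> p = complex_of_real (1 / (1 + (\<Sum>k<n. cmod (c v k p))))" for p
  define g where "g j p = \<psi> p * c v j p" for j p
  have pos: "0 < 1 + (\<Sum>k<n. cmod (c v k p))" for p
    by (simp add: add_pos_nonneg sum_nonneg)
  have \<psi>_meas [measurable]: "\<psi> \<in> borel_measurable \<mu>" unfolding \<psi>_def by measurable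
  have g_meas [measurable]: "g j \<in> borel_measurable \<mu>" for j unfolding g_def by measurable
  have cmod_\<psi>: "cmod (\<psi> p) = 1 / (1 + (\<Sum>k<n. cmod (c v k p)))" for p
    using pos[of p] unfolding \<psi>_def by (simp del: of_real_divide)
  have \<psi>_bound: "cmod (\<psi> p) \<le> 1" for p
    using pos[of p] by (simp add: cmod_\<psi> sum_nonneg)
  have g_bound: "cmod (g j p) \<le> 1" if "j < n" for j p
  proof -
    have "cmod (c v j p) \<le> (\<Sum>k<n. cmod (c v k p))"
      using that by (intro member_le_sum) auto
    then show ?thesis using pos[of p] by (simp add: g_def norm_mult cmod_\<psi>)
  qed
  have "mult_op \<psi> v = (\<Sum>j<n. mult_op (g j) (unit_vec j))"
  proof (rule coord_ext)
    fix k assume k: "k < n"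
    have "AE p in \<mu>. \<forall>j<n. c (mult_op (g j) (unit_vec j)) k p = g j p * c (unit_vec j) k p"
      by (intro AE_all_less coord_mult_op[OF g_meas g_bound k])
    moreover have "AE p in \<mu>. \<forall>j<n. c (unit_vec j) k p = (if k = j then 1 else 0)"
      by (intro AE_all_less coord_unit_vec k)
    ultimately show "AE p in \<mu>. c (mult_op \<psi> v) k p = c (\<Sum>j<n. mult_op (g j) (unit_vec j)) k p"
      using coord_mult_op[OF \<psi>_meas \<psi>_bound k, of v]
        coord_sum[OF finite_lessThan k, of "\<lambda>j. mult_op (g j) (unit_vec j)" n]
    proof eventually_elim
      case (elim p)
      have "c (\<Sum>j<n. mult_op (g j) (unit_vec j)) k p = (\<Sum>j<n. g j p * (if k = j then 1 else 0))"
        unfolding elim(4) by (intro sum.cong) (use elim(1,2) in auto)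
      also have "\<dots> = g k p" using k by (simp add: if_distrib cong: if_cong)
      finally show ?case using elim(3) by (simp add: g_def)
    qed
  qed
  then have "X (mult_op \<psi> v) = (\<Sum>j<n. X (mult_op (g j) (unit_vec j)))"
    by (simp add: commuting_sum[OF X])
  moreover have "X (mult_op \<psi> v) = mult_op \<psi> (X v)"
    using X mult_op_in_mult_ops[OF \<psi>_meas \<psi>_bound] by (simp add: commuting_def)
  moreover have "X (mult_op (g j) (unit_vec j)) = mult_op (g j) (X (unit_vec j))" if "j < n" for j
    using X mult_op_in_mult_ops[OF g_meas g_bound[OF that]] by (simp add: commuting_def)
  ultimately have eq: "mult_op \<psi> (X v) = (\<Sum>j<n. mult_op (g j) (X (unit_vec j)))" by simp
  have "AE p in \<mu>. \<forall>j<n. c (mult_op (g j) (X (unit_vec j))) i p = g j p * c (X (unit_vec j)) i p"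
    by (intro AE_all_less coord_mult_op[OF g_meas g_bound i])
  then show ?thesis
    using coord_mult_op[OF \<psi>_meas \<psi>_bound i, of "X v"]
      coord_sum[OF finite_lessThan i, of "\<lambda>j. mult_op (g j) (X (unit_vec j))" n]
  proof eventually_elim
    case (elim p)
    have "\<psi> p * c (X v) i p = (\<Sum>j<n. g j p * c (X (unit_vec j)) i p)"
      using elim by (simp add: eq)
    also have "\<dots> = \<psi> p * (\<Sum>j<n. c (X (unit_vec j)) i p * c v j p)"
      by (simp add: g_def sum_distrib_left mult_ac)
    finally have "\<psi> p * c (X v) i p = \<psi> p * (\<Sum>j<n. c (X (unit_vec j)) i p * c v j p)" .
    moreover have "\<psi> p \<noteq> 0"
      using pos[of p] unfolding \<psi>_def by (simp del: of_real_divide)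
    ultimately show ?case by simp
  qed
qed

text \<open>The matrix unit \<open>E\<^sub>k\<^sub>l\<close>, acting by the same matrix in every
  fibre.\<close>

definition shift :: "nat \<Rightarrow> nat \<Rightarrow> 'a \<Rightarrow> 'a" where
  "shift k l v = vec_of (\<lambda>i p. if i = k then c v l p else 0)"

lemma coord_shift:
  assumes "l < n" "i < n"
  shows "AE p in \<mu>. c (shift k l v) i p = (if i = k then c v l p else 0)"
  unfolding shift_def
proof (rule coord_vec_of[OF _ _ assms(2)])
  show "(\<lambda>p. if j = k then c v l p else 0) \<in> borel_measurable \<mu>" for j
    by (cases "j = k") simp_all
  show "integrable \<mu> (\<lambda>p. (cmod (if j = k then c v l p else 0))\<^sup>2)" for j
    by (cases "j = k") (simp_all add: coord_integrable assms)
qed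

lemma commuting_shift:
  assumes kl: "l < n"
  shows "commuting (shift k l)"
  unfolding commuting_def
proof (intro conjI allI ballI)
  fix v w
  show "shift k l (v + w) = shift k l v + shift k l w"
  proof (rule coord_ext)
    fix i assume i: "i < n"
    show "AE p in \<mu>. c (shift k l (v + w)) i p = c (shift k l v + shift k l w) i p"
      using coord_shift[OF kl i, of k "v + w"] coord_shift[OF kl i, of k v] coord_shift[OF kl i, of k w]
        coord_add[OF kl, of v w] coord_add[OF i, of "shift k l v" "shift k l w"]
      by eventually_elim simp
  qed
next
  fix T v assume "T \<in> mult_ops"
  then obtain \<phi> where \<phi>: "\<And>v i. i < n \<Longrightarrow> AE p in \<mu>. c (T v) i p = \<phi> p * c v i p"
    by (metis mult_opsE)
  show "shift k l (T v) = T (shift k l v)"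
  proof (rule coord_ext)
    fix i assume i: "i < n"
    show "AE p in \<mu>. c (shift k l (T v)) i p = c (T (shift k l v)) i p"
      using coord_shift[OF kl i, of k "T v"] coord_shift[OF kl i, of k v] \<phi>[OF kl, of v]
        \<phi>[OF i, of "shift k l v"]
      by eventually_elim simp
  qed
qed

lemma shift_shift:
  assumes "l < n" "s < n"
  shows "shift k l (shift r s v) = (if l = r then shift k s v else 0)"
proof (rule coord_ext)
  fix i assume i: "i < n"
  show "AE p in \<mu>. c (shift k l (shift r s v)) i p = c (if l = r then shift k s v else 0) i p"
    using coord_shift[OF assms(1) i, of k "shift r s v"] coord_shift[OF assms(2,1), of r v]
      coord_shift[OF assms(2) i, of k v] coord_0[OF i]
    by eventually_elim auto
qed

lemma sum_shift: "(\<Sum>k<n. shift k k v) = v"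
proof (rule coord_ext)
  fix i assume i: "i < n"
  have "AE p in \<mu>. \<forall>k<n. c (shift k k v) i p = (if i = k then c v k p else 0)"
    by (intro AE_all_less coord_shift i)
  then show "AE p in \<mu>. c (\<Sum>k<n. shift k k v) i p = c v i p"
    using coord_sum[OF finite_lessThan i, of "\<lambda>k. shift k k v" n]
    by eventually_elim (use i in simp)
qed

text \<open>Essential boundedness of \<open>\<zeta>\<close> comes from boundedness of
  \<open>Z\<close>. The test vector \<open>w\<close> has coordinate 0 equal to the indicator of the
  set where \<open>\<zeta>\<close> exceeds the bound \<open>K\<close> of \<open>Z\<close>, and all
  others zero; comparing the norms of \<open>Z w\<close> and \<open>w\<close> shows that this set is
  null.\<close>

lemma scalar_in_mult_ops:
  assumes Z: "Z \<in> bounded_ops" and [measurable]: "\<zeta> \<in> borel_measurable \<mu>"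
    and \<zeta>: "\<And>v i. i < n \<Longrightarrow> AE p in \<mu>. c (Z v) i p = \<zeta> p * c v i p"
  shows "Z \<in> mult_ops"
proof -
  obtain K where K: "0 < K" "\<And>x. norm (Z x) \<le> norm x * K"
    using bounded_linear.pos_bounded[OF bounded_opsD(1)[OF Z]] by blast
  define A where "A = {p \<in> space \<mu>. K < cmod (\<zeta> p)}"
  have [measurable]: "A \<in> sets \<mu>" unfolding A_def by measurable
  define f where "f i p = (if i = 0 then indicator A p else 0 :: complex)" for i :: nat and p
  have f2: "(cmod (f i p))\<^sup>2 = (if i = 0 then indicator A p else 0)" for i p
    by (auto simp: f_def indicator_def)
  have int_f: "integrable \<mu> (\<lambda>p. (cmod (f i p))\<^sup>2)" for i
    unfolding f2 by (cases "i = 0") (auto intro!: integrable_const_bound[where B = 1] simp: indicator_def)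
  define w where "w = vec_of f"
  have w: "AE p in \<mu>. c w i p = f i p" if "i < n" for i
    unfolding w_def by (rule coord_vec_of[OF _ int_f that]) (simp add: f_def)
  have w2: "AE p in \<mu>. (cmod (c w i p))\<^sup>2 = (if i = 0 then indicator A p else 0)" if "i < n" for i
    using w[OF that] by eventually_elim (simp only: f2)
  have "(norm w)\<^sup>2 = (\<Sum>i<n. LINT p|\<mu>. (if i = 0 then indicator A p else 0))"
    unfolding norm_sq_coord
    by (intro sum.cong refl integral_cong_AE w2) auto
  also have "\<dots> = (LINT p|\<mu>. indicator A p)"
    using n_pos by (subst sum.remove[of _ 0]) auto
  finally have nw: "(norm w)\<^sup>2 = (LINT p|\<mu>. indicator A p)" .
  have Zw: "AE p in \<mu>. (cmod (c (Z w) i p))\<^sup>2 = (if i = 0 then (cmod (\<zeta> p))\<^sup>2 * indicator A p else 0)"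
    if "i < n" for i
    using \<zeta>[OF that, of w] w[OF that]
    by eventually_elim (auto simp: f_def norm_mult indicator_def)
  have "(norm (Z w))\<^sup>2 = (\<Sum>i<n. LINT p|\<mu>. (if i = 0 then (cmod (\<zeta> p))\<^sup>2 * indicator A p else 0))"
    unfolding norm_sq_coord
    by (intro sum.cong refl integral_cong_AE Zw) auto
  also have "\<dots> = (LINT p|\<mu>. (cmod (\<zeta> p))\<^sup>2 * indicator A p)"
    using n_pos by (subst sum.remove[of _ 0]) auto
  finally have nZw: "(norm (Z w))\<^sup>2 = (LINT p|\<mu>. (cmod (\<zeta> p))\<^sup>2 * indicator A p)" .
  have "integrable \<mu> (\<lambda>p. (cmod (c (Z w) 0 p))\<^sup>2)" by (rule coord_integrable[OF n_pos])
  then have int1: "integrable \<mu> (\<lambda>p. (cmod (\<zeta> p))\<^sup>2 * indicator A p)"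
    by (rule integrable_cong_AE_imp) (use Zw[OF n_pos] in auto)
  have int2: "integrable \<mu> (\<lambda>p. K\<^sup>2 * indicator A p)"
    by (intro integrable_mult_right integrable_const_bound[where B = 1]) (auto simp: indicator_def)
  \<comment> \<open>\<open>h\<close> is nonnegative and strictly positive on \<open>A\<close>, while
    the norm bound makes its integral at most 0.\<close>
  define h where "h p = (cmod (\<zeta> p))\<^sup>2 * indicator A p - K\<^sup>2 * indicator A p" for p
  have h_nonneg: "0 \<le> h p" for p
    using K(1) by (auto simp: h_def A_def indicator_def intro!: power_mono)
  have "(norm (Z w))\<^sup>2 \<le> (norm w * K)\<^sup>2" using K(2) by (intro power_mono) auto
  then have "(LINT p|\<mu>. h p) \<le> 0"
    unfolding h_def using int1 int2 by (simp add: nZw nw power_mult_distrib mult.commute)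
  moreover have "0 \<le> (LINT p|\<mu>. h p)" using h_nonneg by simp
  moreover have int_h: "integrable \<mu> h" unfolding h_def using int1 int2 by auto
  ultimately have "AE p in \<mu>. h p = 0"
    using integral_nonneg_eq_0_iff_AE[OF int_h AE_I2] h_nonneg by (metis order_antisym)
  then have "AE p in \<mu>. cmod (\<zeta> p) \<le> K"
    using AE_space
  proof eventually_elim
    case (elim p)
    show ?case
    proof (rule ccontr)
      assume "\<not> cmod (\<zeta> p) \<le> K"
      then have "p \<in> A" "K\<^sup>2 < (cmod (\<zeta> p))\<^sup>2"
        using elim K(1) by (auto simp: A_def intro: power_strict_mono)
      then show False using elim by (simp add: h_def)
    qed
  qed
  then show ?thesis unfolding mult_ops_def using assms by blast
qed

text \<open>The hypotheses \<open>P\<close> and \<open>conj\<close> express the easy inclusion for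
  \<open>V\<close>; they make conjugation by \<open>adj V\<close> preserve the commutant.
  \<open>Q\<close> makes this conjugation multiplicative, so it carries matrix units to matrix
  units.\<close>

lemma adj_conj_in_mult_ops:
  assumes V: "partial_isometry V" and Q: "range_projection V \<in> mult_ops"
    and P: "\<And>X x. X \<in> mult_ops \<Longrightarrow> X (adj V (V x)) = adj V (V (X x))"
    and conj: "\<And>X. X \<in> mult_ops \<Longrightarrow> V \<circ> X \<circ> adj V \<in> mult_ops"
    and Y: "Y \<in> mult_ops"
  shows "adj V \<circ> Y \<circ> V \<in> mult_ops"
proof -
  note V' = partial_isometryD[OF V]
  note Va = adj_in_bounded_ops[OF V'(1)]
  note lin = bounded_opsD(2,4)[OF V'(1)] bounded_opsD(2,4)[OF Va]
  have commuting_conj: "commuting (adj V \<circ> X \<circ> V)" if X: "commuting X" for X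
    unfolding commuting_def
  proof (intro conjI allI ballI)
    show "(adj V \<circ> X \<circ> V) (v + w) = (adj V \<circ> X \<circ> V) v + (adj V \<circ> X \<circ> V) w" for v w
      using X by (simp add: lin commuting_def)
    fix T v assume T: "T \<in> mult_ops"
    \<comment> \<open>\<open>V \<circ> T\<close> equals
      \<open>(V \<circ> T \<circ> adj V) \<circ> V\<close>, and the bracket lies in
      \<open>mult_ops\<close>, so \<open>X\<close> can be moved past it.\<close>
    have "V (T v) = (V \<circ> T \<circ> adj V) (V v)"
      using P[OF T, of v] V'(2)[of "T v"] by simp
    moreover have "X ((V \<circ> T \<circ> adj V) (V v)) = (V \<circ> T \<circ> adj V) (X (V v))"
      using X conj[OF T] unfolding commuting_def by blast
    ultimately have "X (V (T v)) = V (T (adj V (X (V v))))" by simp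
    then show "(adj V \<circ> X \<circ> V) (T v) = T ((adj V \<circ> X \<circ> V) v)"
      using P[OF T, symmetric] V'(3) by simp
  qed
  define F where "F k l = adj V \<circ> shift k l \<circ> V" for k l
  define Z where "Z = adj V \<circ> Y \<circ> V"
  have Yb: "Y \<in> bounded_ops" using Y by (rule mult_opsE)
  have Y_comm: "commuting Y"
    unfolding commuting_def using mult_ops_commute[OF Y] bounded_opsD(2)[OF Yb] by auto
  have F: "commuting (F k l)" if "l < n" for k l
    unfolding F_def by (rule commuting_conj[OF commuting_shift[OF that]])
  have Z: "commuting Z" unfolding Z_def by (rule commuting_conj[OF Y_comm])
  \<comment> \<open>\<open>X\<close> commutes with the range projection of \<open>V\<close>, which
    \<open>adj V\<close> on the left then swallows.\<close>
  have absorb: "adj V (X (V (adj V x))) = adj V (X x)" if "commuting X" for X x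
  proof -
    have "X (range_projection V x) = range_projection V (X x)"
      using that Q unfolding commuting_def by blast
    then show ?thesis by (simp add: range_projection_def V')
  qed
  have FF: "F k l (F r s v) = (if l = r then F k s v else 0)" if "l < n" "s < n" for k l r s v
    using that by (simp add: F_def absorb[OF commuting_shift] shift_shift lin)
  have ZF: "Z (F k l v) = F k l (Z v)" if "l < n" for k l v
    using that commuting_shift[OF that, of k] Y
    by (simp add: F_def Z_def absorb[OF commuting_shift] absorb[OF Y_comm] commuting_def)
  have adj_sum: "adj V (\<Sum>k<m. g k) = (\<Sum>k<m. adj V (g k))" for g and m :: nat
    by (induction m) (auto simp: lin)
  have Z1: "(\<Sum>k<n. Z (F k k v)) = Z v" for v
  proof -
    have "(\<Sum>k<n. F k k v) = adj V (V v)"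
      using arg_cong[OF sum_shift[of "V v"], of "adj V"] by (simp add: F_def adj_sum)
    then have "(\<Sum>k<n. Z (F k k v)) = Z (adj V (V v))"
      by (simp flip: commuting_sum[OF Z])
    then show ?thesis by (simp add: Z_def V')
  qed
  \<comment> \<open>Entries of the fibre matrices of the \<open>F k l\<close> and of
    \<open>Z\<close>.\<close>
  define f where "f k l i j p = c (F k l (unit_vec j)) i p" for k l i j p
  define z where "z i j p = c (Z (unit_vec j)) i p" for i j p
  \<comment> \<open>Operator identities turn into matrix identities: by decomposability the
    coordinates of a composite at \<open>unit_vec j\<close> are entries of a matrix product. As the
    indices are finitely many, one null set serves all of them.\<close>
  have "AE p in \<mu>. \<forall>k<n. \<forall>l<n. \<forall>r<n. \<forall>s<n. \<forall>i<n. \<forall>j<n.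
      (\<Sum>m<n. f k l i m p * f r s m j p) = (if l = r then f k s i j p else 0)"
  proof (intro AE_all_less)
    fix k l r s i j assume *: "k < n" "l < n" "r < n" "s < n" "i < n" "j < n"
    show "AE p in \<mu>. (\<Sum>m<n. f k l i m p * f r s m j p) = (if l = r then f k s i j p else 0)"
      using commuting_decomposable[OF F[OF *(2)] *(5), of k "F r s (unit_vec j)"] coord_0[OF *(5)]
      by eventually_elim (auto simp: f_def FF * split: if_splits)
  qed
  moreover have "AE p in \<mu>. \<forall>k<n. \<forall>l<n. \<forall>i<n. \<forall>j<n.
      (\<Sum>m<n. z i m p * f k l m j p) = (\<Sum>m<n. f k l i m p * z m j p)"
  proof (intro AE_all_less)
    fix k l i j assume *: "k < n" "l < n" "i < n" "j < n"
    show "AE p in \<mu>. (\<Sum>m<n. z i m p * f k l m j p) = (\<Sum>m<n. f k l i m p * z m j p)"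
      using commuting_decomposable[OF F[OF *(2)] *(3), of k "Z (unit_vec j)"]
        commuting_decomposable[OF Z *(3), of "F k l (unit_vec j)"]
      by eventually_elim (simp add: f_def z_def ZF *)
  qed
  moreover have "AE p in \<mu>. \<forall>i<n. \<forall>j<n. z i j p = (\<Sum>k<n. \<Sum>m<n. z i m p * f k k m j p)"
  proof (intro AE_all_less)
    fix i j assume *: "i < n" "j < n"
    have "AE p in \<mu>. \<forall>k<n. c (Z (F k k (unit_vec j))) i p = (\<Sum>m<n. z i m p * f k k m j p)"
      unfolding z_def f_def by (intro AE_all_less commuting_decomposable Z *)
    then show "AE p in \<mu>. z i j p = (\<Sum>k<n. \<Sum>m<n. z i m p * f k k m j p)"
      using coord_sum[OF finite_lessThan *(1), of "\<lambda>k. Z (F k k (unit_vec j))" n]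
      by eventually_elim (simp add: z_def Z1)
  qed
  ultimately have scalar: "AE p in \<mu>. \<forall>i<n. \<forall>j<n. z i j p = (if i = j then z 0 0 p else 0)"
  proof eventually_elim
    case (elim p)
    show ?case
    proof (intro allI impI)
      fix i j assume ij: "i < n" "j < n"
      show "z i j p = (if i = j then z 0 0 p else 0)"
        by (rule commutes_with_matrix_units_imp_scalar[of n "\<lambda>k l i j. f k l i j p" "\<lambda>i j. z i j p"])
          (rule elim[rule_format] | assumption | rule ij)+
    qed
  qed
  have "AE p in \<mu>. c (Z v) i p = z 0 0 p * c v i p" if i: "i < n" for v i
    using commuting_decomposable[OF Z i, of v] scalar
  proof eventually_elim
    case (elim p)
    have "c (Z v) i p = (\<Sum>j<n. (if i = j then z 0 0 p else 0) * c v j p)"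
      unfolding elim(1) using elim(2) i by (intro sum.cong) (auto simp: z_def)
    also have "\<dots> = (\<Sum>j<n. if i = j then z 0 0 p * c v j p else 0)"
      by (intro sum.cong) auto
    finally show ?case using i by simp
  qed
  moreover have "Z \<in> bounded_ops" unfolding Z_def by (intro bounded_ops_comp Va Yb V')
  moreover have "z 0 0 \<in> borel_measurable \<mu>" unfolding z_def by measurable
  ultimately show ?thesis using scalar_in_mult_ops unfolding Z_def by blast
qed

end

section \<open>Measurable orthonormal frames\<close>

lemma orthonormal_independent:
  assumes "orthonormal (B :: 'a::complex_hilbert set)"
  shows "\<not> complex_vector.dependent B"
  unfolding complex_vector.independent_explicit_finite_subsets
proof (intro allI impI ballI)
  fix S u v assume S: "S \<subseteq> B" "finite S" "(\<Sum>v\<in>S. u v *\<^sub>C v) = 0" and v: "v \<in> S"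
  have "0 = (\<Sum>w\<in>S. u w * cinner w v)"
    using arg_cong[OF S(3), of "\<lambda>x. cinner x v"] by (simp add: cinner_sum_left cinner_scaleC_left)
  also have "\<dots> = (\<Sum>w\<in>S. if w = v then u v else 0)"
  proof (intro sum.cong refl)
    fix w assume "w \<in> S"
    then have "cinner w v = (if w = v then 1 else 0)"
      using assms S(1) v unfolding orthonormal_def by blast
    then show "u w * cinner w v = (if w = v then u v else 0)" by simp
  qed
  finally show "u v = 0" using S(2) v by simp
qed

lemma continuous_scaleC_cinner:
  "continuous_on UNIV (\<lambda>x::'a::complex_hilbert. cinner x b *\<^sub>C d)"
proof (rule bounded_linear.continuous_on[OF _ continuous_on_id])
  show "bounded_linear (\<lambda>x. cinner x b *\<^sub>C d)"
  proof (rule bounded_linear_intro[of _ "norm b * norm d"])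
    show "norm (cinner x b *\<^sub>C d) \<le> norm x * (norm b * norm d)" for x
      using mult_right_mono[OF cauchy_schwarz[of x b], of "norm d"] by (simp add: norm_scaleC mult.assoc)
  qed (simp_all add: cinner_add_left scaleC_add_left scaleR_eq_scaleC cinner_scaleC_left scaleC_scaleC)
qed

text \<open>The vectors equal to their finite Fourier sum form a closed subspace containing
  \<open>A\<close>.\<close>

lemma orthonormal_expansion:
  assumes fin: "finite A" and on: "orthonormal (A :: 'a::complex_hilbert set)"
    and x: "x \<in> closure (cspan A)"
  shows "x = (\<Sum>b\<in>A. cinner x b *\<^sub>C b)"
proof -
  let ?E = "{x. x = (\<Sum>b\<in>A. cinner x b *\<^sub>C b)}"
  have "cspan A \<subseteq> ?E"
  proof (rule complex_vector.span_minimal)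
    show "A \<subseteq> ?E"
    proof
      fix a assume a: "a \<in> A"
      have "(\<Sum>b\<in>A. cinner a b *\<^sub>C b) = (\<Sum>b\<in>A. if b = a then a else 0)"
        using on a by (intro sum.cong) (auto simp: orthonormal_def scaleC_one)
      then show "a \<in> ?E" using fin a by simp
    qed
    show "csubspace ?E"
      unfolding complex_vector.subspace_def
    proof (intro conjI ballI allI)
      show "0 \<in> ?E" by simp
    next
      fix x y assume "x \<in> ?E" "y \<in> ?E"
      then have 1: "x + y = (\<Sum>b\<in>A. cinner x b *\<^sub>C b) + (\<Sum>b\<in>A. cinner y b *\<^sub>C b)"
        by (intro arg_cong2[of _ _ _ _ plus]) blast+
      have 2: "\<dots> = (\<Sum>b\<in>A. cinner (x + y) b *\<^sub>C b)"
        by (simp add: cinner_add_left scaleC_add_left sum.distrib)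
      from trans[OF 1 2] show "x + y \<in> ?E" by blast
    next
      fix a x assume "x \<in> ?E"
      then have 1: "a *\<^sub>C x = a *\<^sub>C (\<Sum>b\<in>A. cinner x b *\<^sub>C b)"
        by (intro arg_cong[of _ _ "scaleC a"]) blast
      have 2: "\<dots> = (\<Sum>b\<in>A. cinner (a *\<^sub>C x) b *\<^sub>C b)"
        by (simp add: cinner_scaleC_left complex_vector.scale_sum_right scaleC_scaleC)
      from trans[OF 1 2] show "a *\<^sub>C x \<in> ?E" by blast
    qed
  qed
  moreover have "closed ?E"
    by (intro closed_Collect_eq continuous_on_id continuous_on_sum continuous_scaleC_cinner)
  ultimately have "closure (cspan A) \<subseteq> ?E" by (rule closure_minimal)
  then show ?thesis using x by blast
qed

lemma closure_span_orthonormal: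
  assumes "finite A" "orthonormal (A :: 'a::complex_hilbert set)"
  shows "closure (cspan A) = cspan A"
proof -
  have "x \<in> cspan A" if "x \<in> closure (cspan A)" for x
  proof -
    have "(\<Sum>b\<in>A. cinner x b *\<^sub>C b) \<in> cspan A"
      by (intro complex_vector.span_sum complex_vector.span_scale complex_vector.span_base)
    then show ?thesis using orthonormal_expansion[OF assms that] by simp
  qed
  then show ?thesis using closure_subset by blast
qed

lemma closure_span_minimal:
  "A \<subseteq> cspan B \<Longrightarrow> closure (cspan A) \<subseteq> closure (cspan (B :: 'a::complex_hilbert set))"
  by (intro closure_mono complex_vector.span_minimal complex_vector.subspace_span)

section \<open>Gram-Schmidt orthonormalisation and its measurability\<close>

definition residual :: "(nat \<Rightarrow> 'a::complex_hilbert) \<Rightarrow> nat \<Rightarrow> 'a \<Rightarrow> 'a" where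
  "residual u j x = x - (\<Sum>i<j. cinner x (u i) *\<^sub>C u i)"

text \<open>Vectors of the input sequence that lie in the span of the earlier output are skipped, so that
  the output has no gaps: the first zero entry occurs at the dimension of the span.\<close>

function gram_schmidt :: "(nat \<Rightarrow> 'a::complex_hilbert) \<Rightarrow> nat \<Rightarrow> 'a" where
  "gram_schmidt a j = (let r = (\<lambda>k. a k - (\<Sum>i<j. cinner (a k) (gram_schmidt a i) *\<^sub>C gram_schmidt a i))
     in if \<exists>k. r k \<noteq> 0 then complex_of_real (1 / norm (r (LEAST k. r k \<noteq> 0))) *\<^sub>C r (LEAST k. r k \<noteq> 0) else 0)"
  by pat_completeness auto
termination by (relation "Wellfounded.measure snd") auto

declare gram_schmidt.simps [simp del]

lemma gram_schmidt_eq: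
  "gram_schmidt a j = (if \<exists>k. residual (gram_schmidt a) j (a k) \<noteq> 0
     then let x = residual (gram_schmidt a) j (a (LEAST k. residual (gram_schmidt a) j (a k) \<noteq> 0))
       in complex_of_real (1 / norm x) *\<^sub>C x
     else 0)"
  by (subst gram_schmidt.simps) (simp add: residual_def Let_def)

text \<open>The family may contain zero vectors, as the output of \<open>gram_schmidt\<close> does;
  for \<open>u l = 0\<close> the claim is trivial.\<close>

lemma residual_orthogonal:
  assumes "\<And>i l. i < j \<Longrightarrow> l < j \<Longrightarrow> cinner (u i) (u l) = (if i = l \<and> u i \<noteq> 0 then 1 else 0)"
    and l: "l < j"
  shows "cinner (residual u j x) (u l) = 0"
proof -
  have "cinner (\<Sum>i<j. cinner x (u i) *\<^sub>C u i) (u l) = (\<Sum>i<j. cinner x (u i) * cinner (u i) (u l))"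
    by (simp add: cinner_sum_left cinner_scaleC_left)
  also have "\<dots> = (\<Sum>i<j. if i = l then cinner x (u l) else 0)"
    using assms by (intro sum.cong) auto
  finally show ?thesis using l by (simp add: residual_def cinner_diff_left)
qed

lemma gram_schmidt_orthonormal:
  "cinner (gram_schmidt a i) (gram_schmidt a l) = (if i = l \<and> gram_schmidt a i \<noteq> 0 then 1 else 0)"
proof -
  let ?u = "gram_schmidt a"
  have "\<forall>i<j. \<forall>l<j. cinner (?u i) (?u l) = (if i = l \<and> ?u i \<noteq> 0 then 1 else 0)" for j
  proof (induction j)
    case (Suc j)
    have orth: "cinner (?u j) (?u l) = 0" if "l < j" for l
      using residual_orthogonal[of j ?u l] Suc that
      by (subst gram_schmidt_eq) (auto simp: Let_def cinner_scaleC_left)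
    then have orth': "cinner (?u l) (?u j) = 0" if "l < j" for l
      using that by (subst cinner_commute) simp
    have self: "cinner (?u j) (?u j) = 1" if "?u j \<noteq> 0"
    proof -
      define x where "x = residual ?u j (a (LEAST k. residual ?u j (a k) \<noteq> 0))"
      have eq: "?u j = complex_of_real (1 / norm x) *\<^sub>C x"
        using that by (subst gram_schmidt_eq) (auto simp: x_def Let_def gram_schmidt_eq[of a j] split: if_splits)
      then have "x \<noteq> 0" using that by auto
      then have "norm (?u j) = 1" unfolding eq by (simp add: norm_scaleC norm_divide)
      then show ?thesis by (simp add: cinner_self)
    qed
    show ?case using Suc orth orth' self by (auto simp: less_Suc_eq)
  qed simp
  from this[of "Suc (max i l)"] show ?thesis by (simp add: less_Suc_eq_le)
qed

lemma gram_schmidt_in_span: "gram_schmidt a j \<in> cspan (range a)"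
proof (induction j rule: less_induct)
  case (less j)
  have "residual (gram_schmidt a) j (a k) \<in> cspan (range a)" for k
    unfolding residual_def
    by (intro complex_vector.span_diff complex_vector.span_sum complex_vector.span_scale less
        complex_vector.span_base) auto
  then show ?case
    by (subst gram_schmidt_eq) (auto simp: Let_def complex_vector.span_zero intro: complex_vector.span_scale)
qed

text \<open>Two dimension counts against \<open>B\<close>. A zero entry before position
  \<open>n\<close> would let fewer than \<open>n\<close> vectors span the space; a vector without
  expansion would yield, by its normalised residual, \<open>n + 1\<close> orthonormal vectors in
  it.\<close>

lemma gram_schmidt_frame:
  assumes B: "finite B" "orthonormal B" and V: "closure (cspan (range a)) = closure (cspan B)"
  defines "n \<equiv> card B"
  shows "j < n \<Longrightarrow> gram_schmidt a j \<noteq> 0"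
    and "x \<in> closure (cspan B) \<Longrightarrow> x = (\<Sum>i<n. cinner x (gram_schmidt a i) *\<^sub>C gram_schmidt a i)"
proof -
  let ?u = "gram_schmidt a"
  have on: "orthonormal (?u ` {..<j})" if "\<And>i. i < j \<Longrightarrow> ?u i \<noteq> 0" for j
    using that by (auto simp: orthonormal_def gram_schmidt_orthonormal)
      (metis gram_schmidt_orthonormal one_neq_zero)
  have nz: "?u j \<noteq> 0" if "j < n" for j
    using that
  proof (induction j rule: less_induct)
    case (less j)
    have on_j: "orthonormal (?u ` {..<j})" using on less by simp
    show ?case
    proof
      assume "?u j = 0"
      have "residual ?u j (a k) = 0" for k
      proof (rule ccontr)
        assume "residual ?u j (a k) \<noteq> 0"
        then have ex: "\<exists>k. residual ?u j (a k) \<noteq> 0" by blast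
        then have "?u j \<noteq> 0"
          using LeastI_ex[OF ex] by (subst gram_schmidt_eq) (auto simp: Let_def)
        then show False using \<open>?u j = 0\<close> by simp
      qed
      then have "a k = (\<Sum>i<j. cinner (a k) (?u i) *\<^sub>C ?u i)" for k
        by (simp add: residual_def)
      moreover have "(\<Sum>i<j. cinner (a k) (?u i) *\<^sub>C ?u i) \<in> cspan (?u ` {..<j})" for k
        by (intro complex_vector.span_sum complex_vector.span_scale complex_vector.span_base) auto
      ultimately have "range a \<subseteq> cspan (?u ` {..<j})" by auto
      then have "closure (cspan B) \<subseteq> cspan (?u ` {..<j})"
        using closure_span_minimal[of "range a"] closure_span_orthonormal[OF _ on_j] V by auto
      then have "B \<subseteq> cspan (?u ` {..<j})"
        using closure_subset complex_vector.span_superset by blast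
      then have "card B \<le> card (?u ` {..<j})"
        using complex_vector.independent_span_bound orthonormal_independent[OF B(2)] by blast
      also have "\<dots> \<le> j" using card_image_le[of "{..<j}" ?u] by simp
      finally show False using less.prems n_def by simp
    qed
  qed
  then show "j < n \<Longrightarrow> ?u j \<noteq> 0" .
  show "x = (\<Sum>i<n. cinner x (?u i) *\<^sub>C ?u i)" if x: "x \<in> closure (cspan B)"
  proof (rule ccontr)
    assume neq: "x \<noteq> (\<Sum>i<n. cinner x (?u i) *\<^sub>C ?u i)"
    define r where "r = residual ?u n x"
    have r: "r \<noteq> 0" using neq by (simp add: r_def residual_def)
    have r_orth: "cinner r (?u i) = 0" if "i < n" for i
      unfolding r_def by (rule residual_orthogonal[OF gram_schmidt_orthonormal that])
    define w where "w = complex_of_real (1 / norm r) *\<^sub>C r"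
    have w_orth: "cinner w (?u i) = 0" "cinner (?u i) w = 0" if "i < n" for i
      using r_orth[OF that] cinner_commute[of r "?u i"] by (simp_all add: w_def cinner_scaleC_left cinner_scaleC_right)
    have "norm w = 1" using r by (simp add: w_def norm_scaleC norm_divide)
    then have w1: "cinner w w = 1" by (simp add: cinner_self)
    let ?A = "?u ` {..<n}"
    have "inj_on ?u {..<n}"
      by (rule inj_onI) (metis gram_schmidt_orthonormal lessThan_iff nz zero_neq_one)
    then have card_A: "card ?A = n" by (simp add: card_image)
    have w_notin: "w \<notin> ?A" using w_orth w1 by auto
    have "orthonormal (insert w ?A)"
      using on[OF nz] w_orth w1 w_notin unfolding orthonormal_def by (auto split: if_splits)
    moreover have span_B: "closure (cspan B) = cspan B" by (rule closure_span_orthonormal[OF B])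
    have u_B: "?u i \<in> cspan B" for i
      using gram_schmidt_in_span[of a i] closure_subset[of "cspan (range a)"] V span_B by auto
    have "r \<in> cspan B"
      unfolding r_def residual_def using x span_B
      by (intro complex_vector.span_diff complex_vector.span_sum complex_vector.span_scale u_B) auto
    then have "insert w ?A \<subseteq> cspan B" using u_B by (auto simp: w_def intro: complex_vector.span_scale)
    ultimately have "card (insert w ?A) \<le> card B"
      using complex_vector.independent_span_bound[OF B(1)] orthonormal_independent by blast
    then show False using w_notin card_A n_def by simp
  qed
qed

text \<open>Measurability of a vector field is meant weakly, through inner products. The field
  \<open>g\<close> is generalised in the induction because the earlier output must be paired both
  with \<open>g\<close> and with the \<open>e k\<close>.\<close>

lemma measurable_gram_schmidt:
  fixes e :: "nat \<Rightarrow> 'm \<Rightarrow> 'a::complex_hilbert"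
  assumes e: "\<And>j k. (\<lambda>p. cinner (e j p) (e k p)) \<in> borel_measurable \<mu>"
    and g: "\<And>k. (\<lambda>p. cinner (g p) (e k p)) \<in> borel_measurable \<mu>"
  shows "(\<lambda>p. cinner (g p) (gram_schmidt (\<lambda>k. e k p) j)) \<in> borel_measurable \<mu>"
  using g
proof (induction j arbitrary: g rule: less_induct)
  case (less j)
  define u where "u i p = gram_schmidt (\<lambda>k. e k p) i" for i p
  define r where "r k p = residual (\<lambda>i. u i p) j (e k p)" for k p
  have flip: "(\<lambda>p. cinner (f p) (h p)) \<in> borel_measurable \<mu>"
    if "(\<lambda>p. cinner (h p) (f p)) \<in> borel_measurable \<mu>" for f h :: "'m \<Rightarrow> 'a"
    by (subst cinner_commute)
      (rule measurable_compose[OF that borel_measurable_continuous_onI[OF continuous_on_cnj[OF continuous_on_id]]])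
  have r1: "(\<lambda>p. cinner (h p) (r k p)) \<in> borel_measurable \<mu>"
    if h: "\<And>k. (\<lambda>p. cinner (h p) (e k p)) \<in> borel_measurable \<mu>" for h k
  proof -
    have hu: "(\<lambda>p. cinner (h p) (u i p)) \<in> borel_measurable \<mu>"
      and eu: "(\<lambda>p. cinner (e k p) (u i p)) \<in> borel_measurable \<mu>" if "i < j" for i
      unfolding u_def using less.IH[OF that] h e by blast+
    have ue: "(\<lambda>p. cinner (u i p) (e k p)) \<in> borel_measurable \<mu>" if "i < j" for i
      by (rule flip) (rule eu[OF that])
    have [measurable]: "(\<lambda>p. cinner (h p) (e k p)) \<in> borel_measurable \<mu>" by (rule h)
    have "(\<lambda>p. cinner (h p) (e k p) - (\<Sum>i<j. cinner (u i p) (e k p) * cinner (h p) (u i p)))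
        \<in> borel_measurable \<mu>"
      by (intro borel_measurable_diff borel_measurable_sum borel_measurable_times h hu ue) simp_all
    moreover have "cinner (h p) (r k p) =
        cinner (h p) (e k p) - (\<Sum>i<j. cinner (u i p) (e k p) * cinner (h p) (u i p))" for p
      by (simp add: r_def residual_def cinner_diff_right cinner_sum_right cinner_scaleC_right
          flip: cinner_commute)
    ultimately show ?thesis by simp
  qed
  have rr: "(\<lambda>p. cinner (r k p) (r k p)) \<in> borel_measurable \<mu>" for k
    by (rule r1, rule flip, rule r1, rule e)
  have [measurable]: "Measurable.pred \<mu> (\<lambda>p. r k p \<noteq> 0)" for k
  proof -
    have "Measurable.pred \<mu> (\<lambda>p. cinner (r k p) (r k p) \<noteq> 0)" using rr[of k] by measurable
    then show ?thesis by simp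
  qed
  \<comment> \<open>The selected input index varies with \<open>p\<close> but takes countably many
    values, so the selected residual is pasted from measurable pieces.\<close>
  define K where "K p = (LEAST k. r k p \<noteq> 0)" for p
  have K: "K \<in> \<mu> \<rightarrow>\<^sub>M count_space UNIV" unfolding K_def by measurable
  have [measurable]: "(\<lambda>p. cinner (g p) (r k p)) \<in> borel_measurable \<mu>" for k
    by (rule r1) (rule less.prems)
  have [measurable]: "(\<lambda>p. norm (r k p)) \<in> borel_measurable \<mu>" for k
  proof -
    have "(\<lambda>p. sqrt (Re (cinner (r k p) (r k p)))) \<in> borel_measurable \<mu>"
      using rr[of k] by measurable
    then show ?thesis by (simp add: cinner_self)
  qed
  have "(\<lambda>p. complex_of_real (1 / norm (r (K p) p)) * cinner (g p) (r (K p) p)) \<in> borel_measurable \<mu>"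
    by (rule measurable_compose_countable[OF _ K]) measurable
  then have "(\<lambda>p. if \<exists>k. r k p \<noteq> 0
      then complex_of_real (1 / norm (r (K p) p)) * cinner (g p) (r (K p) p) else 0) \<in> borel_measurable \<mu>"
    by measurable
  moreover have "cinner (g p) (u j p) = (if \<exists>k. r k p \<noteq> 0
      then complex_of_real (1 / norm (r (K p) p)) * cinner (g p) (r (K p) p) else 0)" for p
    unfolding u_def by (subst gram_schmidt_eq)
      (auto simp: Let_def r_def u_def K_def cinner_scaleC_right)
  ultimately show ?case by (simp add: u_def)
qed

section \<open>Uniform multiplicity in coordinates\<close>

text \<open>Trivialises the direct integral: the coordinates of \<open>v\<close> are the Fourier
  coefficients of \<open>U v\<close> in the measurable orthonormal frame obtained from the
  fundamental sequence \<open>e\<close>.\<close>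

lemma coordinate_model_of_direct_integral:
  fixes \<mu> :: "real measure" and H :: "real \<Rightarrow> 'a::complex_hilbert set"
  assumes \<mu>: "regular_borel_measure \<Omega> \<mu>" and field: "measurable_field \<mu> H e"
    and U: "direct_integral_unitary \<mu> H e U"
    and dim: "AE p in \<mu>. has_hilbert_dim (H p) (enat n)" and n: "0 < n"
  obtains c where "coordinate_model \<mu> n c" "coordinate_model.mult_ops \<mu> n c = diagonalizable_ops \<mu> U"
proof -
  define u where "u i p = gram_schmidt (\<lambda>k. e k p) i" for i p
  define c where "c = (\<lambda>v i p. cinner (U v p) (u i p))"
  interpret finite_measure \<mu> using \<mu> by (simp add: regular_borel_measure_def)
  have H: "closed (H p)" "csubspace (H p)" "closure (cspan (range (\<lambda>k. e k p))) = H p" if "p \<in> space \<mu>" for p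
    using field that by (auto simp: measurable_field_def)
  have e_meas: "(\<lambda>p. cinner (e j p) (e k p)) \<in> borel_measurable \<mu>" for j k
    using field by (simp add: measurable_field_def)
  have u_meas: "(\<lambda>p. cinner (g p) (u i p)) \<in> borel_measurable \<mu>"
    if "\<And>k. (\<lambda>p. cinner (g p) (e k p)) \<in> borel_measurable \<mu>" for g i
    unfolding u_def by (rule measurable_gram_schmidt[OF e_meas that])
  have flip: "(\<lambda>p. cinner (f p) (h p)) \<in> borel_measurable \<mu>"
    if "(\<lambda>p. cinner (h p) (f p)) \<in> borel_measurable \<mu>" for f h :: "real \<Rightarrow> 'a"
    by (subst cinner_commute)
      (rule measurable_compose[OF that borel_measurable_continuous_onI[OF continuous_on_cnj[OF continuous_on_id]]])
  have uu: "cinner (u i p) (u l p) = (if i = l \<and> u i p \<noteq> 0 then 1 else 0)" for i l p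
    unfolding u_def by (rule gram_schmidt_orthonormal)
  have u_H: "u i p \<in> H p" if "p \<in> space \<mu>" for i p
    using gram_schmidt_in_span[of "\<lambda>k. e k p" i] closure_subset[of "cspan (range (\<lambda>k. e k p))"] H(3)[OF that]
    unfolding u_def by blast
  \<comment> \<open>Where the fibre has dimension \<open>n\<close>, the first \<open>n\<close>
    Gram-Schmidt vectors form an orthonormal basis of it.\<close>
  have "AE p in \<mu>. (\<forall>i<n. u i p \<noteq> 0) \<and> (\<forall>x\<in>H p. x = (\<Sum>i<n. cinner x (u i p) *\<^sub>C u i p))"
    using dim AE_space
  proof eventually_elim
    case (elim p)
    then obtain B where B: "orthonormal B" "closure (cspan B) = H p"
      and card: "enat n = (if finite B then enat (card B) else \<infinity>)"
      unfolding has_hilbert_dim_def by blast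
    have fin: "finite B" and n: "n = card B" using card by (auto split: if_splits)
    have "closure (cspan (range (\<lambda>k. e k p))) = closure (cspan B)" using H(3)[OF elim(2)] B(2) by simp
    from gram_schmidt_frame[OF fin B(1) this] show ?case
      unfolding u_def n B(2) by blast
  qed
  then have u_nz: "AE p in \<mu>. \<forall>i<n. u i p \<noteq> 0"
    and expand: "AE p in \<mu>. \<forall>x\<in>H p. x = (\<Sum>i<n. cinner x (u i p) *\<^sub>C u i p)"
    by auto
  have U_field: "U v \<in> direct_integral \<mu> H e"
    and U_add: "AE p in \<mu>. U (v + w) p = U v p + U w p"
    and U_scaleC: "AE p in \<mu>. U (a *\<^sub>C v) p = a *\<^sub>C U v p"
    and U_cinner: "cinner v w = (LINT p|\<mu>. cinner (U v p) (U w p))" for v w a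
    using U unfolding direct_integral_unitary_def by blast+
  have U_surj: "\<exists>v. AE p in \<mu>. U v p = f p" if "f \<in> direct_integral \<mu> H e" for f
    using U that unfolding direct_integral_unitary_def by blast
  have UH: "U v p \<in> H p" if "p \<in> space \<mu>" for v p
    using U_field[of v] that by (simp add: direct_integral_def)
  have U_int: "integrable \<mu> (\<lambda>p. (norm (U v p))\<^sup>2)" for v
    using U_field[of v] by (simp add: direct_integral_def)
  have Ue: "(\<lambda>p. cinner (U v p) (e k p)) \<in> borel_measurable \<mu>" for v k
    using U_field[of v] unfolding direct_integral_def mem_Collect_eq by (elim conjE) (rule spec)
  have c_meas: "c v i \<in> borel_measurable \<mu>" for v i
    using u_meas[OF Ue, of v i] by (simp add: c_def)
  have norm_u: "norm (u i p) \<le> 1" for i p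
  proof -
    have "(norm (u i p))\<^sup>2 \<le> 1\<^sup>2" using uu[of i p i] by (simp add: norm_sq_eq)
    then show ?thesis by (rule power2_le_imp_le) simp
  qed
  have c_int: "integrable \<mu> (\<lambda>p. (cmod (c v i p))\<^sup>2)" for v i
  proof (rule Bochner_Integration.integrable_bound[OF U_int[of v]])
    have "cmod (c v i p) \<le> norm (U v p)" for p
      using cauchy_schwarz[of "U v p" "u i p"] mult_left_mono[OF norm_u[of i p], of "norm (U v p)"]
      by (simp add: c_def)
    then show "AE p in \<mu>. norm ((cmod (c v i p))\<^sup>2) \<le> norm ((norm (U v p))\<^sup>2)"
      by (auto intro: power_mono)
  qed (use c_meas in measurable)
  have U_expand: "AE p in \<mu>. U v p = (\<Sum>i<n. c v i p *\<^sub>C u i p)" for v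
    using expand AE_space by eventually_elim (use UH in \<open>auto simp: c_def\<close>)
  \<comment> \<open>Stated at every \<open>p\<close>, including the null set where some
    \<open>u i p\<close> vanishes. There it still bounds the norm by the coefficients.\<close>
  have norm_sum: "(norm (\<Sum>i<n. a i *\<^sub>C u i p))\<^sup>2 = (\<Sum>i<n. if u i p = 0 then 0 else (cmod (a i))\<^sup>2)" for a p
  proof -
    have "complex_of_real ((norm (\<Sum>i<n. a i *\<^sub>C u i p))\<^sup>2) =
        (\<Sum>i<n. \<Sum>l<n. cnj (a i) * (a l * cinner (u l p) (u i p)))"
      by (simp add: cinner_self[symmetric] cinner_sum_left cinner_sum_right cinner_scaleC_left
          cinner_scaleC_right sum_distrib_left del: of_real_power)
    also have "\<dots> = (\<Sum>i<n. \<Sum>l<n. if i = l then (if u i p = 0 then 0 else complex_of_real ((cmod (a i))\<^sup>2)) else 0)"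
      by (intro sum.cong refl) (auto simp: uu complex_norm_square mult.commute simp del: of_real_power)
    also have "\<dots> = complex_of_real (\<Sum>i<n. if u i p = 0 then 0 else (cmod (a i))\<^sup>2)"
      by (simp add: if_distrib[of complex_of_real] cong: if_cong)
    finally show ?thesis using of_real_eq_iff by blast
  qed
  have model: "coordinate_model \<mu> n c"
  proof
    show "0 < n" by (rule n)
    show "c v i \<in> borel_measurable \<mu>" for v i by (rule c_meas)
    show "integrable \<mu> (\<lambda>p. (cmod (c v i p))\<^sup>2)" for v i by (rule c_int)
    show "AE p in \<mu>. c (v + w) i p = c v i p + c w i p" for v w i
      using U_add[of v w] by eventually_elim (simp add: c_def cinner_add_left)
    show "AE p in \<mu>. c (a *\<^sub>C v) i p = a * c v i p" for a v i
      using U_scaleC[of a v] by eventually_elim (simp add: c_def cinner_scaleC_left)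
    show "(norm v)\<^sup>2 = (\<Sum>i<n. LINT p|\<mu>. (cmod (c v i p))\<^sup>2)" for v
    proof -
      have "complex_of_real ((norm v)\<^sup>2) = (LINT p|\<mu>. cinner (U v p) (U v p))"
        unfolding cinner_self[symmetric] by (rule U_cinner)
      also have "\<dots> = complex_of_real (LINT p|\<mu>. (norm (U v p))\<^sup>2)"
        by (simp add: cinner_self del: of_real_power)
      finally have "(norm v)\<^sup>2 = (LINT p|\<mu>. (norm (U v p))\<^sup>2)" using of_real_eq_iff by blast
      also have "\<dots> = (LINT p|\<mu>. (\<Sum>i<n. (cmod (c v i p))\<^sup>2))"
      proof (rule integral_cong_AE)
        show "AE p in \<mu>. (norm (U v p))\<^sup>2 = (\<Sum>i<n. (cmod (c v i p))\<^sup>2)"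
          using U_expand[of v] u_nz by eventually_elim (simp add: norm_sum)
        show "(\<lambda>p. (norm (U v p))\<^sup>2) \<in> borel_measurable \<mu>" using U_int by blast
        show "(\<lambda>p. \<Sum>i<n. (cmod (c v i p))\<^sup>2) \<in> borel_measurable \<mu>" using c_meas by measurable
      qed
      also have "\<dots> = (\<Sum>i<n. LINT p|\<mu>. (cmod (c v i p))\<^sup>2)" by (rule Bochner_Integration.integral_sum) (rule c_int)
      finally show ?thesis .
    qed
    show "\<exists>v. \<forall>i<n. AE p in \<mu>. c v i p = f i p"
      if f: "\<And>i. i < n \<Longrightarrow> f i \<in> borel_measurable \<mu>"
        and f_int: "\<And>i. i < n \<Longrightarrow> integrable \<mu> (\<lambda>p. (cmod (f i p))\<^sup>2)" for f
    proof -
      \<comment> \<open>The vector field with prescribed coordinates \<open>f\<close>; surjectivity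
        of \<open>U\<close> then supplies the vector.\<close>
      define F where "F p = (\<Sum>i<n. f i p *\<^sub>C u i p)" for p
      have Fe: "(\<lambda>p. cinner (F p) (e k p)) \<in> borel_measurable \<mu>" for k
      proof -
        have "(\<lambda>p. \<Sum>i<n. f i p * cinner (u i p) (e k p)) \<in> borel_measurable \<mu>"
          by (intro borel_measurable_sum borel_measurable_times f) (auto intro: flip u_meas e_meas)
        then show ?thesis by (simp add: F_def cinner_sum_left cinner_scaleC_left)
      qed
      have "F p \<in> H p" if "p \<in> space \<mu>" for p
        unfolding F_def
        by (intro complex_vector.subspace_sum[OF H(2)[OF that]] complex_vector.subspace_scale[OF H(2)[OF that]]
            u_H that)
      moreover have "integrable \<mu> (\<lambda>p. (norm (F p))\<^sup>2)"
      proof (rule Bochner_Integration.integrable_bound)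
        show "integrable \<mu> (\<lambda>p. \<Sum>i<n. (cmod (f i p))\<^sup>2)"
          by (rule Bochner_Integration.integrable_sum) (simp add: f_int)
        have "(\<lambda>p. \<Sum>i<n. f i p * cinner (u i p) (F p)) \<in> borel_measurable \<mu>"
          by (intro borel_measurable_sum borel_measurable_times f flip[OF u_meas[OF Fe]]) simp
        \<comment> \<open>Only inner products of fields are known to be measurable, so the norm is
          expressed through them.\<close>
        moreover have "(norm (F p))\<^sup>2 = Re (\<Sum>i<n. f i p * cinner (u i p) (F p))" for p
          unfolding norm_sq_eq by (subst (1) F_def) (simp add: cinner_sum_left cinner_scaleC_left)
        ultimately show "(\<lambda>p. (norm (F p))\<^sup>2) \<in> borel_measurable \<mu>"
          by (simp only: measurable_compose[OF _ borel_measurable_Re])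
        show "AE p in \<mu>. norm ((norm (F p))\<^sup>2) \<le> norm (\<Sum>i<n. (cmod (f i p))\<^sup>2)"
          by (intro AE_I2) (auto simp: F_def norm_sum sum_nonneg intro!: sum_mono)
      qed
      ultimately have "F \<in> direct_integral \<mu> H e" using Fe by (simp add: direct_integral_def)
      then obtain v where v: "AE p in \<mu>. U v p = F p"
        using U_surj by blast
      have "AE p in \<mu>. c v i p = f i p" if i: "i < n" for i
        using v u_nz
      proof eventually_elim
        case (elim p)
        have "c v i p = (\<Sum>l<n. f l p * cinner (u l p) (u i p))"
          by (simp add: c_def elim(1) F_def cinner_sum_left cinner_scaleC_left)
        also have "\<dots> = (\<Sum>l<n. if l = i then f i p else 0)"
          using elim(2) i by (intro sum.cong) (auto simp: uu)
        finally show ?case using i by simp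
      qed
      then show ?thesis by blast
    qed
  qed
  have iff: "(AE p in \<mu>. U w p = \<phi> p *\<^sub>C U v p) \<longleftrightarrow> (\<forall>i<n. AE p in \<mu>. c w i p = \<phi> p * c v i p)"
    for v w \<phi>
  proof
    assume a: "AE p in \<mu>. U w p = \<phi> p *\<^sub>C U v p"
    show "\<forall>i<n. AE p in \<mu>. c w i p = \<phi> p * c v i p"
      using a by (auto simp: c_def cinner_scaleC_left elim!: eventually_mono)
  next
    assume "\<forall>i<n. AE p in \<mu>. c w i p = \<phi> p * c v i p"
    then have "AE p in \<mu>. \<forall>i<n. c w i p = \<phi> p * c v i p"
      by (simp add: coordinate_model.AE_all_less[OF model])
    then show "AE p in \<mu>. U w p = \<phi> p *\<^sub>C U v p"
      using U_expand[of v] U_expand[of w]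
      by eventually_elim (simp add: complex_vector.scale_sum_right scaleC_scaleC)
  qed
  have "coordinate_model.mult_ops \<mu> n c = diagonalizable_ops \<mu> U"
    unfolding coordinate_model.mult_ops_def[OF model] diagonalizable_ops_def by (simp add: iff)
  with model show ?thesis by (rule that)
qed

section \<open>Invariance of the algebra of range projections under the generated semigroup\<close>

theorem theorem3p14:
  fixes S :: "('a::complex_hilbert \<Rightarrow> 'a) set"
  assumes separable: "\<exists>D :: 'a set. countable D \<and> closure D = UNIV"
    and infinite_dimensional: "\<not> (\<exists>B :: 'a set. finite B \<and> cspan B = UNIV)"
    and semigroup: "operator_semigroup S"
    and unital: "id \<in> S"
    and partial_isometries: "\<forall>V\<in>S. partial_isometry V"
    and commutative: "commutative_set (range_projection ` S)"
    and multiplicity: "uniform_finite_multiplicity (generated_vN (range_projection ` S))"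
  shows "\<forall>T\<in>generated_semigroup (S \<union> adj ` S). partial_isometry T"
proof -
  define N where "N = generated_vN (range_projection ` S)"
  obtain n where "n < \<infinity>" "uniform_multiplicity N n"
    using multiplicity by (auto simp: uniform_finite_multiplicity_def N_def)
  then obtain m where m: "uniform_multiplicity N (enat m)" by (cases n) auto
  then obtain \<Omega> \<mu> H e U where d: "regular_borel_measure \<Omega> \<mu>" "measurable_field \<mu> H e"
      "direct_integral_unitary \<mu> H e U" "AE p in \<mu>. has_hilbert_dim (H p) (enat m)"
    and N_diag: "N = diagonalizable_ops \<mu> U"
    unfolding uniform_multiplicity_def by blast
  have "0 < m" using m by (auto simp: uniform_multiplicity_def one_enat_def)
  from coordinate_model_of_direct_integral[OF d this] obtain c where
    model: "coordinate_model \<mu> m c" and N: "coordinate_model.mult_ops \<mu> m c = N"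
    by (auto simp: N_diag)
  interpret coordinate_model \<mu> m c by (rule model)
  have S_bounded: "V \<in> bounded_ops" if "V \<in> S" for V
    using partial_isometries that by (simp add: partial_isometry_def)
  have vN: "von_neumann_algebra N"
    unfolding N_def by (rule von_neumann_algebra_generated_vN) (auto intro: range_projection_selfadjoint S_bounded)
  have Q: "range_projection V \<in> N" if "V \<in> S" for V
    using generated_vN_superset that unfolding N_def by blast
  \<comment> \<open>The easy inclusion together with commutation with
    \<open>adj V \<circ> V\<close>. Both are checked on range projections and extended to
    \<open>N\<close> by minimality of the generated algebra.\<close>
  have gen: "X \<in> bounded_ops \<and> V \<circ> X \<circ> adj V \<in> N \<and> (\<forall>x. X (adj V (V x)) = adj V (V (X x)))"
    if V: "V \<in> S" and X: "X \<in> N" for V X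
  proof -
    have "N \<subseteq> {X \<in> bounded_ops. V \<circ> X \<circ> adj V \<in> N \<and> (\<forall>x. X (adj V (V x)) = adj V (V (X x)))}"
      (is "_ \<subseteq> ?M")
      unfolding N_def
    proof (rule generated_vN_least)
      show "von_neumann_algebra {X \<in> bounded_ops. V \<circ> X \<circ> adj V \<in> generated_vN (range_projection ` S) \<and>
          (\<forall>x. X (adj V (V x)) = adj V (V (X x)))}"
        using von_neumann_algebra_conj_commutant[OF vN _ Q[OF V]] partial_isometries V
        by (simp add: N_def)
      show "range_projection ` S \<subseteq> {X \<in> bounded_ops. V \<circ> X \<circ> adj V \<in> generated_vN (range_projection ` S) \<and>
          (\<forall>x. X (adj V (V x)) = adj V (V (X x)))}"
      proof safe
        fix B assume B: "B \<in> S"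
        have VB: "V \<circ> B \<in> S" using semigroup V B by (simp add: operator_semigroup_def)
        show "range_projection B \<in> bounded_ops" by (intro range_projection_selfadjoint S_bounded B)
        \<comment> \<open>Conjugating a range projection by \<open>V\<close> gives the range
          projection of \<open>V \<circ> B\<close>, and \<open>S\<close> is closed under
          products.\<close>
        have "V \<circ> range_projection B \<circ> adj V = range_projection (V \<circ> B)"
          by (simp add: range_projection_def adj_comp S_bounded V B o_assoc)
        then show "V \<circ> range_projection B \<circ> adj V \<in> generated_vN (range_projection ` S)"
          using Q[OF VB] by (simp add: N_def)
        show "range_projection B (adj V (V x)) = adj V (V (range_projection B x))" for x
          using initial_commutes_range[of V B x] partial_isometries V B VB
          by (simp add: range_projection_def)
      qed
    qed
    then show ?thesis using X by blast
  qed
  have conj_adj: "adj V \<circ> X \<circ> V \<in> N" if V: "V \<in> S" and X: "X \<in> N" for V X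
  proof -
    have "adj V \<circ> X \<circ> V \<in> mult_ops"
      by (rule adj_conj_in_mult_ops) (use partial_isometries V X Q gen N in auto)
    then show ?thesis by (simp add: N)
  qed
  have id: "id \<in> N" using id_in_mult_ops N by simp
  \<comment> \<open>The induction carries invariance of \<open>N\<close> under conjugation by
    \<open>T\<close> on both sides, since partial isometries alone are not closed under
    products.\<close>
  have "partial_isometry T \<and> (\<forall>X\<in>N. T \<circ> X \<circ> adj T \<in> N \<and> adj T \<circ> X \<circ> T \<in> N)"
    if "T \<in> generated_semigroup (S \<union> adj ` S)" for T
    using that
  proof (induction rule: generated_semigroup.induct)
    case (base T)
    then consider "T \<in> S" | V where "V \<in> S" "T = adj V" by blast
    then show ?case
    proof cases
      case 1
      then show ?thesis using partial_isometries gen conj_adj by blast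
    next
      case (2 V)
      \<comment> \<open>Passing to the adjoint merely exchanges the two inclusions.\<close>
      then have "adj T = V" by (simp add: adj_adj S_bounded)
      then show ?thesis
        unfolding 2(2) using 2 partial_isometries gen conj_adj partial_isometry_adj by metis
    qed
  next
    case (mult R T)
    have R: "R \<in> bounded_ops" and T: "T \<in> bounded_ops"
      using mult.IH by (auto simp: partial_isometry_def)
    \<comment> \<open>Conjugating \<open>id\<close> places the initial projection of
      \<open>R\<close> and the final projection of \<open>T\<close> in the abelian algebra
      \<open>N\<close>, so they commute and \<open>partial_isometry_comp\<close> applies.\<close>
    have RR: "adj R \<circ> id \<circ> R \<in> mult_ops" and TT: "T \<circ> id \<circ> adj T \<in> mult_ops"
      using mult.IH id unfolding N by blast+
    have "partial_isometry (R \<circ> T)"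
      using mult.IH mult_ops_commute[OF RR TT] by (intro partial_isometry_comp) auto
    moreover have "(R \<circ> T) \<circ> X \<circ> adj (R \<circ> T) \<in> N" "adj (R \<circ> T) \<circ> X \<circ> (R \<circ> T) \<in> N" if X: "X \<in> N" for X
    proof -
      have "R \<circ> (T \<circ> X \<circ> adj T) \<circ> adj R \<in> N" "adj T \<circ> (adj R \<circ> X \<circ> R) \<circ> T \<in> N"
        using mult.IH X by blast+
      then show "(R \<circ> T) \<circ> X \<circ> adj (R \<circ> T) \<in> N" "adj (R \<circ> T) \<circ> X \<circ> (R \<circ> T) \<in> N"
        by (simp_all add: adj_comp R T o_assoc)
    qed
    ultimately show ?case by blast
  qed
  then show ?thesis by blast
qed

end
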